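(* Let $B$ be an unbounded self-adjoint operator in $\mathcal{H}$. Then there are infinitely many pairs $\langle B_1,B_2\rangle$ of closed densely defined restrictions of $B$ such that (1) $\operatorname{dom}B_1\cap\operatorname{dom}B_2=\{0\}$; (2) $\operatorname{dom}B=\operatorname{dom}B_1\dotplus\operatorname{dom}B_2$; (3) $\operatorname{dom}B_1\cap\operatorname{dom}B^2=\operatorname{dom}B_2\cap\operatorname{dom}B^2=\{0\}$; (4) $\operatorname{dom}(BB_1)=\operatorname{dom}(BB_2)=\{0\}$; in particular $\operatorname{dom}B_1^2=\operatorname{dom}B_2^2=\{0\}$. If moreover $\operatorname{ran}B=\mathcal{H}$, then for $k=1,2$: (5) $B_kB$ is densely defined (and non-negative symmetric); (6) $B^2$ is the Friedrichs extension of $B_kB$; (7) $(B_kB)^*=BB_k^*$; (8) $\operatorname{dom}(B_1B)\cap\operatorname{dom}(B_2B)=\{0\}$ and $\operatorname{dom}(B_1B)\dotplus\operatorname{dom}(B_2B)=\operatorname{dom}B^2$; (9) the Kreĭn extension of $B_kB$ is $B_kB_k^*$.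
   Context: $\mathcal{H}$ is a complex, infinite-dimensional, separable Hilbert space. Products of unbounded operators have their natural domains, $\operatorname{dom}(ST)=\{f\in\operatorname{dom}T:Tf\in\operatorname{dom}S\}$. For a densely defined closed non-negative symmetric operator $\mathcal{A}$: the Friedrichs extension is the non-negative self-adjoint operator associated with the closure of the form $(\mathcal{A}f,g)$ on $\operatorname{dom}\mathcal{A}$ (maximal non-negative self-adjoint extension); the Kreĭn extension $\mathcal{A}_K$ is the minimal non-negative self-adjoint extension, i.e. $(\mathcal{A}_F+aI)^{-1}\le(\mathcal{C}+aI)^{-1}\le(\mathcal{A}_K+aI)^{-1}$, $a>0$, for every non-negative self-adjoint extension $\mathcal{C}$. $\dotplus$ denotes a direct sum. *)

theory Defs
  imports "HOL-Analysis.Analysis"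
begin

class complex_hilbert = banach +
  fixes scaleC :: "complex \<Rightarrow> 'a \<Rightarrow> 'a"
    and cinner :: "'a \<Rightarrow> 'a \<Rightarrow> complex"
  assumes scaleC_add_right: "scaleC a (x + y) = scaleC a x + scaleC a y"
    and scaleC_add_left: "scaleC (a + b) x = scaleC a x + scaleC b x"
    and scaleC_scaleC: "scaleC a (scaleC b x) = scaleC (a * b) x"
    and scaleC_one: "scaleC 1 x = x"
    and scaleR_scaleC: "scaleR r x = scaleC (complex_of_real r) x"
    and cinner_add_left: "cinner (x + y) z = cinner x z + cinner y z"
    and cinner_scaleC_left: "cinner (scaleC a x) y = a * cinner x y"
    and cinner_commute: "cinner x y = cnj (cinner y x)"
    and cinner_self_norm: "cinner x x = complex_of_real ((norm x)\<^sup>2)"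

definition cspan :: "'a::complex_hilbert set \<Rightarrow> 'a set" where
  "cspan S = {(\<Sum>i\<in>F. scaleC (c i) i) | F c. finite F \<and> F \<subseteq> S}"

definition separable_infdim :: "'a::complex_hilbert itself \<Rightarrow> bool" where
  "separable_infdim _ \<longleftrightarrow>
     (\<exists>D::'a set. countable D \<and> closure D = UNIV) \<and>
     (\<forall>S::'a set. finite S \<longrightarrow> cspan S \<noteq> UNIV)"

definition is_op :: "('a::complex_hilbert \<times> 'a) set \<Rightarrow> bool" where
  "is_op T \<longleftrightarrow> (0, 0) \<in> T
     \<and> (\<forall>f g f' g'. (f, g) \<in> T \<longrightarrow> (f', g') \<in> T \<longrightarrow> (f + f', g + g') \<in> T)
     \<and> (\<forall>c f g. (f, g) \<in> T \<longrightarrow> (scaleC c f, scaleC c g) \<in> T)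
     \<and> (\<forall>g. (0, g) \<in> T \<longrightarrow> g = 0)"

definition op_dom :: "('a \<times> 'a) set \<Rightarrow> 'a set" where
  "op_dom T = fst ` T"

definition op_ran :: "('a \<times> 'a) set \<Rightarrow> 'a set" where
  "op_ran T = snd ` T"

definition op_app :: "('a \<times> 'a) set \<Rightarrow> 'a \<Rightarrow> 'a" where
  "op_app T f = (THE g. (f, g) \<in> T)"

definition op_comp :: "('a \<times> 'a) set \<Rightarrow> ('a \<times> 'a) set \<Rightarrow> ('a \<times> 'a) set" where
  "op_comp S T = {(f, h). \<exists>g. (f, g) \<in> T \<and> (g, h) \<in> S}"

definition densely_defined :: "('a::topological_space \<times> 'a) set \<Rightarrow> bool" where
  "densely_defined T \<longleftrightarrow> closure (op_dom T) = UNIV"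

definition closed_op :: "('a::complex_hilbert \<times> 'a) set \<Rightarrow> bool" where
  "closed_op T \<longleftrightarrow> is_op T \<and> closed T"

definition adjoint :: "('a::complex_hilbert \<times> 'a) set \<Rightarrow> ('a \<times> 'a) set" where
  "adjoint T = {(g, h). \<forall>f k. (f, k) \<in> T \<longrightarrow> cinner k g = cinner f h}"

definition self_adjoint :: "('a::complex_hilbert \<times> 'a) set \<Rightarrow> bool" where
  "self_adjoint T \<longleftrightarrow> is_op T \<and> densely_defined T \<and> adjoint T = T"

definition symmetric_op :: "('a::complex_hilbert \<times> 'a) set \<Rightarrow> bool" where
  "symmetric_op T \<longleftrightarrow> is_op T \<and> densely_defined T \<and> T \<subseteq> adjoint T"

definition unbounded_op :: "('a::complex_hilbert \<times> 'a) set \<Rightarrow> bool" where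
  "unbounded_op T \<longleftrightarrow> \<not> (\<exists>C. \<forall>(f, g) \<in> T. norm g \<le> C * norm f)"

definition nonneg_op :: "('a::complex_hilbert \<times> 'a) set \<Rightarrow> bool" where
  "nonneg_op T \<longleftrightarrow> (\<forall>(f, g) \<in> T. Im (cinner g f) = 0 \<and> 0 \<le> Re (cinner g f))"

definition set_sum :: "'a::ab_group_add set \<Rightarrow> 'a set \<Rightarrow> 'a set" where
  "set_sum X Y = {x + y | x y. x \<in> X \<and> y \<in> Y}"

section \<open>Friedrichs extension (via the closure of the form (Af,g))\<close>

definition form_approx :: "('a::complex_hilbert \<times> 'a) set \<Rightarrow> (nat \<Rightarrow> 'a) \<Rightarrow> 'a \<Rightarrow> bool" where
  "form_approx A F f \<longleftrightarrow> (\<forall>n. F n \<in> op_dom A) \<and> F \<longlonglongrightarrow> f \<and>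
     (\<forall>e>0. \<exists>N. \<forall>m\<ge>N. \<forall>n\<ge>N. Re (cinner (op_app A (F n - F m)) (F n - F m)) < e)"

definition form_dom :: "('a::complex_hilbert \<times> 'a) set \<Rightarrow> 'a set" where
  "form_dom A = {f. \<exists>F. form_approx A F f}"

definition form_val :: "('a::complex_hilbert \<times> 'a) set \<Rightarrow> 'a \<Rightarrow> 'a \<Rightarrow> complex" where
  "form_val A f g = (THE c. \<forall>F G. form_approx A F f \<longrightarrow> form_approx A G g \<longrightarrow>
        (\<lambda>n. cinner (op_app A (F n)) (G n)) \<longlonglongrightarrow> c)"

text \<open>The operator associated with the closed form.\<close>
definition friedrichs_ext :: "('a::complex_hilbert \<times> 'a) set \<Rightarrow> ('a \<times> 'a) set" where
  "friedrichs_ext A = {(u, w). u \<in> form_dom A \<and>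
        (\<forall>v \<in> form_dom A. form_val A u v = cinner w v)}"

section \<open>Krein extension (minimal non-negative self-adjoint extension)\<close>

definition op_shift :: "('a::complex_hilbert \<times> 'a) set \<Rightarrow> real \<Rightarrow> ('a \<times> 'a) set" where
  "op_shift C a = {(x, y + scaleR a x) | x y. (x, y) \<in> C}"

definition op_resolvent :: "('a::complex_hilbert \<times> 'a) set \<Rightarrow> real \<Rightarrow> 'a \<Rightarrow> 'a" where
  "op_resolvent C a f = (THE x. (x, f) \<in> op_shift C a)"

definition resolvent_le :: "('a::complex_hilbert \<times> 'a) set \<Rightarrow> ('a \<times> 'a) set \<Rightarrow> bool" where
  "resolvent_le C D \<longleftrightarrow> (\<forall>a>0. \<forall>f.
      Re (cinner (op_resolvent C a f) f) \<le> Re (cinner (op_resolvent D a f) f))"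

definition nonneg_sa_ext :: "('a::complex_hilbert \<times> 'a) set \<Rightarrow> ('a \<times> 'a) set \<Rightarrow> bool" where
  "nonneg_sa_ext A C \<longleftrightarrow> self_adjoint C \<and> nonneg_op C \<and> A \<subseteq> C"

definition is_krein_ext :: "('a::complex_hilbert \<times> 'a) set \<Rightarrow> ('a \<times> 'a) set \<Rightarrow> bool" where
  "is_krein_ext A K \<longleftrightarrow> nonneg_sa_ext A K \<and> (\<forall>C. nonneg_sa_ext A C \<longrightarrow> resolvent_le C K)"

end

(*
  With R = (B - i)^-1, the pairs are B_1 = B restricted to R M and B_2 = B restricted to R M^perp,
  where M is a closed subspace such that both M and M^perp meet dom B only in 0.  Membership of
  B f in dom B (f = R x) means x in dom B, which gives (3) and (4); density of R M is dual to
  M^perp meeting dom B trivially.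

  To find M, choose a sequence w_0, w_1, ... of pairwise orthogonal vectors such that the linear
  span of the w_n meets dom B only in 0, while {R w_2n} and {R w_(2n+1)} are dense.  Given the span F
  of the vectors chosen so far, R F^perp is dense because F meets dom B trivially, and a vector of
  F^perp outside F + dom B exists because F + dom B = H would make B bounded, by the uniform
  boundedness principle.  Any vector of dom B orthogonal to all w_2n (or to all w_(2n+1)) then
  vanishes.  Every target being approximated infinitely often, one odd vector w_(2k+1) may be
  omitted, and M_k = {w_(2n+1) : n /= k}^perp are infinitely many choices.

  If B is onto, (5)-(9) hold for every closed densely defined restriction T of B.  The form of TB is
  (Bf, Bg), whose closure has domain dom B.  T T* is self-adjoint by von Neumann's theorem; its
  minimality is an algebraic identity for resolvents.
*)
theory Submission
  imports Defs
begin

section \<open>Hilbert space preliminaries\<close>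

lemma cinner_zero_left [simp]: "cinner 0 (y::'a::complex_hilbert) = 0"
  using cinner_add_left[of 0 0 y] by simp

lemma cinner_add_right: "cinner (x::'a::complex_hilbert) (y + z) = cinner x y + cinner x z"
  by (metis cinner_add_left cinner_commute complex_cnj_add)

lemma cinner_scaleC_right: "cinner (x::'a::complex_hilbert) (scaleC a y) = cnj a * cinner x y"
  by (metis cinner_commute cinner_scaleC_left complex_cnj_mult)

lemma cinner_zero_right [simp]: "cinner (y::'a::complex_hilbert) 0 = 0"
  using cinner_add_right[of y 0 0] by simp

lemma cinner_minus_left [simp]: "cinner (- x) (y::'a::complex_hilbert) = - cinner x y"
  using cinner_add_left[of x "- x" y] by (simp add: eq_neg_iff_add_eq_0 add.commute)

lemma cinner_minus_right [simp]: "cinner (x::'a::complex_hilbert) (- y) = - cinner x y"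
  using cinner_add_right[of x y "- y"] by (simp add: eq_neg_iff_add_eq_0 add.commute)

lemma cinner_diff_left: "cinner (x - y) (z::'a::complex_hilbert) = cinner x z - cinner y z"
  using cinner_add_left[of x "- y" z] by simp

lemma cinner_diff_right: "cinner (x::'a::complex_hilbert) (y - z) = cinner x y - cinner x z"
  using cinner_add_right[of x y "- z"] by simp

lemma scaleC_zero_left [simp]: "scaleC 0 (x::'a::complex_hilbert) = 0"
  using scaleC_add_left[of 0 0 x] by simp

lemma scaleC_zero_right [simp]: "scaleC c (0::'a::complex_hilbert) = 0"
  using scaleC_add_right[of c 0 0] by simp

lemma scaleC_minus_right: "scaleC c (- x::'a::complex_hilbert) = - scaleC c x"
  using scaleC_add_right[of c x "- x"] by (simp add: eq_neg_iff_add_eq_0 add.commute)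

lemma scaleC_minus_left: "scaleC (- c) (x::'a::complex_hilbert) = - scaleC c x"
  using scaleC_add_left[of c "- c" x] by (simp add: eq_neg_iff_add_eq_0 add.commute)

lemma scaleC_diff_right: "scaleC c (x - y::'a::complex_hilbert) = scaleC c x - scaleC c y"
  using scaleC_add_right[of c x "- y"] by (simp add: scaleC_minus_right)

lemma scaleC_minus_one: "scaleC (- 1) (x::'a::complex_hilbert) = - x"
  by (simp add: scaleC_minus_left scaleC_one)

lemmas cinner_simps = cinner_add_left cinner_add_right cinner_diff_left cinner_diff_right
  cinner_scaleC_left cinner_scaleC_right

lemma cinner_scaleR_left: "cinner (scaleR r x) (y::'a::complex_hilbert) = of_real r * cinner x y"
  by (simp add: scaleR_scaleC cinner_scaleC_left)

lemma cinner_scaleR_right: "cinner (x::'a::complex_hilbert) (scaleR r y) = of_real r * cinner x y"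
  by (simp add: scaleR_scaleC cinner_scaleC_right)

lemma cinner_eq_zero_commute: "cinner (x::'a::complex_hilbert) y = 0 \<longleftrightarrow> cinner y x = 0"
  using cinner_commute[of x y] by simp

lemma Re_cinner_commute: "Re (cinner (x::'a::complex_hilbert) y) = Re (cinner y x)"
  using cinner_commute[of x y] by simp

lemma Re_cinner_self: "Re (cinner x (x::'a::complex_hilbert)) = (norm x)\<^sup>2"
  by (simp add: cinner_self_norm)

lemma cinner_self_eq_zero [simp]: "cinner x (x::'a::complex_hilbert) = 0 \<longleftrightarrow> x = 0"
  by (simp add: cinner_self_norm)

lemma norm_scaleC: "norm (scaleC c (x::'a::complex_hilbert)) = cmod c * norm x"
proof -
  have "complex_of_real ((norm (scaleC c x))\<^sup>2) = c * cnj c * complex_of_real ((norm x)\<^sup>2)"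
    by (simp only: cinner_self_norm[symmetric] cinner_scaleC_left cinner_scaleC_right mult.assoc mult.left_commute)
  also have "\<dots> = complex_of_real ((cmod c * norm x)\<^sup>2)"
    by (simp add: complex_norm_square[symmetric] power_mult_distrib)
  finally have "(norm (scaleC c x))\<^sup>2 = (cmod c * norm x)\<^sup>2"
    using of_real_eq_iff by blast
  then show ?thesis
    by (simp add: power2_eq_iff_nonneg)
qed

lemma norm_add_squared:
  "(norm (x + y::'a::complex_hilbert))\<^sup>2 = (norm x)\<^sup>2 + 2 * Re (cinner x y) + (norm y)\<^sup>2"
  unfolding Re_cinner_self[symmetric] by (simp add: cinner_simps Re_cinner_commute[of y x])

lemma norm_diff_squared:
  "(norm (x - y::'a::complex_hilbert))\<^sup>2 = (norm x)\<^sup>2 - 2 * Re (cinner x y) + (norm y)\<^sup>2"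
  using norm_add_squared[of x "- y"] by simp

text \<open>Pythagoras for the component of \<open>x\<close> orthogonal to \<open>y\<close>.
  Nonnegativity of the left side gives Cauchy-Schwarz; the strict decrease when
  \<open>cinner x y\<close> is nonzero drives the projection theorem.\<close>

lemma norm_minus_component:
  assumes "(y::'a::complex_hilbert) \<noteq> 0"
  shows "(norm (x - scaleC (cinner x y / of_real ((norm y)\<^sup>2)) y))\<^sup>2
    = (norm x)\<^sup>2 - (cmod (cinner x y))\<^sup>2 / (norm y)\<^sup>2"
proof -
  let ?c = "cinner x y / of_real ((norm y)\<^sup>2)"
  have "Re (cinner x (scaleC ?c y)) = (cmod (cinner x y))\<^sup>2 / (norm y)\<^sup>2"
  proof -
    have "cinner x (scaleC ?c y) = of_real ((cmod (cinner x y))\<^sup>2 / (norm y)\<^sup>2)"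
      by (simp add: cinner_scaleC_right complex_norm_square[symmetric] mult.commute[of "cnj _"])
    then show ?thesis by simp
  qed
  moreover have "(norm (scaleC ?c y))\<^sup>2 = (cmod (cinner x y))\<^sup>2 / (norm y)\<^sup>2"
    using assms
    by (simp add: norm_scaleC norm_divide power_divide power2_eq_square del: of_real_power of_real_mult)
  ultimately show ?thesis
    by (simp add: norm_diff_squared)
qed

lemma cinner_Cauchy_Schwarz: "cmod (cinner x (y::'a::complex_hilbert)) \<le> norm x * norm y"
proof (cases "y = 0")
  case False
  have "0 \<le> (norm x)\<^sup>2 - (cmod (cinner x y))\<^sup>2 / (norm y)\<^sup>2"
    unfolding norm_minus_component[OF False, symmetric] by simp
  then have "(cmod (cinner x y))\<^sup>2 \<le> (norm x * norm y)\<^sup>2"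
    using False by (simp add: divide_le_eq power_mult_distrib)
  then show ?thesis
    by (rule power2_le_imp_le) simp
qed simp

lemma bounded_bilinear_cinner: "bounded_bilinear (cinner :: 'a::complex_hilbert \<Rightarrow> 'a \<Rightarrow> complex)"
  by unfold_locales
    (auto simp: cinner_simps cinner_scaleR_left cinner_scaleR_right scaleR_conv_of_real
      intro!: exI[of _ 1] cinner_Cauchy_Schwarz)

lemmas tendsto_cinner = bounded_bilinear.tendsto[OF bounded_bilinear_cinner]

lemma bounded_linear_scaleC: "bounded_linear (scaleC c :: 'a::complex_hilbert \<Rightarrow> 'a)"
  by (rule bounded_linear_intro[of _ "cmod c"])
    (auto simp: scaleC_add_right scaleR_scaleC scaleC_scaleC norm_scaleC mult.commute)

lemmas tendsto_scaleC = bounded_linear.tendsto[OF bounded_linear_scaleC]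

text \<open>Operators are graphs in a product space. With this Hilbert structure the projection
  theorem applies to the graphs themselves.\<close>

instantiation prod :: (complex_hilbert, complex_hilbert) complex_hilbert
begin

definition scaleC_prod :: "complex \<Rightarrow> 'a \<times> 'b \<Rightarrow> 'a \<times> 'b" where
  "scaleC_prod c p = (scaleC c (fst p), scaleC c (snd p))"

definition cinner_prod :: "'a \<times> 'b \<Rightarrow> 'a \<times> 'b \<Rightarrow> complex" where
  "cinner_prod p q = cinner (fst p) (fst q) + cinner (snd p) (snd q)"

instance
proof
  fix p q :: "'a \<times> 'b"
  show "cinner p q = cnj (cinner q p)"
    unfolding cinner_prod_def by (simp flip: cinner_commute)
qed (auto simp: scaleC_prod_def cinner_prod_def scaleC_add_right scaleC_add_left scaleC_scaleC
    scaleC_one scaleR_scaleC cinner_simps algebra_simps cinner_self_norm norm_prod_def prod_eq_iff)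

end

section \<open>Subspaces, orthogonal complements and the projection theorem\<close>

definition is_csubspace :: "'a::complex_hilbert set \<Rightarrow> bool" where
  "is_csubspace S \<longleftrightarrow> 0 \<in> S \<and> (\<forall>x\<in>S. \<forall>y\<in>S. x + y \<in> S) \<and> (\<forall>c. \<forall>x\<in>S. scaleC c x \<in> S)"

lemma is_csubspaceD:
  assumes "is_csubspace S"
  shows "0 \<in> S" "x \<in> S \<Longrightarrow> y \<in> S \<Longrightarrow> x + y \<in> S" "x \<in> S \<Longrightarrow> scaleC c x \<in> S"
    "x \<in> S \<Longrightarrow> - x \<in> S" "x \<in> S \<Longrightarrow> y \<in> S \<Longrightarrow> x - y \<in> S"
proof -
  show "0 \<in> S" "x \<in> S \<Longrightarrow> y \<in> S \<Longrightarrow> x + y \<in> S" and sc: "x \<in> S \<Longrightarrow> scaleC c x \<in> S" for x y c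
    using assms by (auto simp: is_csubspace_def)
  show "x \<in> S \<Longrightarrow> - x \<in> S" for x
    using sc[of x "- 1"] by (simp add: scaleC_minus_one)
  then show "x \<in> S \<Longrightarrow> y \<in> S \<Longrightarrow> x - y \<in> S" for x y
    using assms by (metis add_uminus_conv_diff is_csubspace_def)
qed

definition orth :: "'a::complex_hilbert set \<Rightarrow> 'a set" where
  "orth S = {x. \<forall>y\<in>S. cinner x y = 0}"

lemma orthI: "(\<And>y. y \<in> S \<Longrightarrow> cinner x y = 0) \<Longrightarrow> x \<in> orth S"
  by (simp add: orth_def)

lemma orthD: "x \<in> orth S \<Longrightarrow> y \<in> S \<Longrightarrow> cinner x y = 0" "x \<in> orth S \<Longrightarrow> y \<in> S \<Longrightarrow> cinner y x = 0"
  by (auto simp: orth_def cinner_eq_zero_commute[of y x])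

lemma is_csubspace_orth: "is_csubspace (orth S)"
  by (auto simp: is_csubspace_def orth_def cinner_simps)

lemma closed_orth: "closed (orth S)"
proof -
  have "closed {x. cinner x y = 0}" for y :: 'a
  proof -
    have "continuous_on UNIV (\<lambda>x. cinner x y)"
      by (intro bounded_bilinear.continuous_on[OF bounded_bilinear_cinner] continuous_intros)
    then show ?thesis
      by (intro closed_Collect_eq continuous_intros)
  qed
  moreover have "orth S = (\<Inter>y\<in>S. {x. cinner x y = 0})"
    by (auto simp: orth_def)
  ultimately show ?thesis by auto
qed

lemma orth_triv: "x \<in> S \<Longrightarrow> x \<in> orth S \<Longrightarrow> x = 0"
  using orthD(1) by force

text \<open>A sequence minimizing the distance to \<open>x\<close> is Cauchy, and a nonzero inner
  product with some \<open>y\<close> in \<open>S\<close> would allow a shorter distance. As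
  \<open>S\<close> need not be closed, the limit is only placed in its closure.\<close>

lemma orth_projection_closure:
  fixes x :: "'a::complex_hilbert"
  assumes S: "is_csubspace S"
  obtains m where "m \<in> closure S" "x - m \<in> orth S"
proof -
  define d where "d = Inf ((\<lambda>y. (norm (x - y))\<^sup>2) ` S)"
  have bdd: "bdd_below ((\<lambda>y. (norm (x - y))\<^sup>2) ` S)"
    by (rule bdd_belowI[of _ 0]) auto
  have ne: "S \<noteq> {}"
    using is_csubspaceD(1)[OF S] by auto
  have d_le: "d \<le> (norm (x - y))\<^sup>2" if "y \<in> S" for y
    unfolding d_def by (rule cINF_lower[OF bdd that])
  have "\<exists>y\<in>S. (norm (x - y))\<^sup>2 < d + e" if "e > 0" for e
    using cINF_less_iff[OF ne bdd, of "d + e"] that unfolding d_def by simp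
  then have "\<exists>y\<in>S. (norm (x - y))\<^sup>2 < d + inverse (real (Suc n))" for n
    by simp
  then obtain s where s: "\<And>n. s n \<in> S" "\<And>n. (norm (x - s n))\<^sup>2 < d + inverse (real (Suc n))"
    by metis
  have close: "(norm (s m - s n))\<^sup>2 \<le> 2 * inverse (real (Suc m)) + 2 * inverse (real (Suc n))" for m n
  proof -
    let ?a = "x - s m" and ?b = "x - s n"
    \<comment> \<open>The midpoint lies in \<open>S\<close>, so its squared distance to
      \<open>x\<close> is at least \<open>d\<close>; the parallelogram law then leaves little room
      for \<open>s m - s n\<close>.\<close>
    have "scaleC (1/2) (s m + s n) \<in> S"
      using S s(1) by (intro is_csubspaceD(2,3)) auto
    then have "d \<le> (norm (x - scaleC (1/2) (s m + s n)))\<^sup>2"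
      by (rule d_le)
    also have "x - scaleC (1/2) (s m + s n) = scaleC (1/2) (?a + ?b)"
    proof -
      have "x = scaleC (1/2) (x + x)"
        by (simp only: scaleC_add_right scaleC_add_left[symmetric]) (simp add: scaleC_one)
      then have "x - scaleC (1/2) (s m + s n) = scaleC (1/2) (x + x) - scaleC (1/2) (s m + s n)"
        by simp
      then show ?thesis
        by (simp add: algebra_simps flip: scaleC_diff_right)
    qed
    finally have "4 * d \<le> (norm (?a + ?b))\<^sup>2"
      by (simp add: norm_scaleC power_divide)
    moreover have "(norm (?a + ?b))\<^sup>2 + (norm (?a - ?b))\<^sup>2 = 2 * (norm ?a)\<^sup>2 + 2 * (norm ?b)\<^sup>2"
      unfolding norm_add_squared norm_diff_squared by simp
    moreover have "?a - ?b = s n - s m" by simp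
    ultimately show ?thesis
      using s(2)[of m] s(2)[of n] by (simp add: norm_minus_commute)
  qed
  have "Cauchy s"
  proof (rule metric_CauchyI)
    fix e :: real assume "e > 0"
    then obtain N where N: "inverse (real (Suc N)) < e\<^sup>2 / 4"
      using reals_Archimedean[of "e\<^sup>2 / 4"] by auto
    have inv_le: "inverse (real (Suc k)) \<le> inverse (real (Suc N))" if "k \<ge> N" for k
      using that by (intro le_imp_inverse_le) auto
    have "dist (s m) (s n) < e" if "m \<ge> N" "n \<ge> N" for m n
    proof -
      have "(norm (s m - s n))\<^sup>2 < e\<^sup>2"
        using close[of m n] N inv_le[OF that(1)] inv_le[OF that(2)] by linarith
      then show ?thesis
        using \<open>e > 0\<close> power2_less_imp_less[of _ e] by (simp add: dist_norm)
    qed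
    then show "\<exists>M. \<forall>m\<ge>M. \<forall>n\<ge>M. dist (s m) (s n) < e" by blast
  qed
  then obtain m where m: "s \<longlonglongrightarrow> m"
    using Cauchy_convergent convergent_def by blast
  have nm: "(norm (x - m))\<^sup>2 \<le> d"
  proof (rule LIMSEQ_le)
    show "(\<lambda>n. (norm (x - s n))\<^sup>2) \<longlonglongrightarrow> (norm (x - m))\<^sup>2"
      using m by (intro tendsto_intros)
    show "(\<lambda>n. d + inverse (real (Suc n))) \<longlonglongrightarrow> d"
      using tendsto_add[OF tendsto_const[of d] LIMSEQ_inverse_real_of_nat] by simp
    show "\<exists>N. \<forall>n\<ge>N. (norm (x - s n))\<^sup>2 \<le> d + inverse (real (Suc n))"
      using s(2) less_imp_le by blast
  qed
  have "cinner (x - m) y = 0" if y: "y \<in> S" for y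
  proof (rule ccontr)
    assume nz: "cinner (x - m) y \<noteq> 0"
    then have y0: "y \<noteq> 0" by auto
    let ?c = "cinner (x - m) y / of_real ((norm y)\<^sup>2)"
    \<comment> \<open>Moving each \<open>s n\<close> along \<open>y\<close> stays in
      \<open>S\<close>; the lower bound \<open>d\<close> survives the limit.\<close>
    have "d \<le> (norm (x - m - scaleC ?c y))\<^sup>2"
    proof (rule LIMSEQ_le_const)
      show "(\<lambda>n. (norm (x - s n - scaleC ?c y))\<^sup>2) \<longlonglongrightarrow> (norm (x - m - scaleC ?c y))\<^sup>2"
        using m by (intro tendsto_intros)
      have "d \<le> (norm (x - s n - scaleC ?c y))\<^sup>2" for n
        using d_le[of "s n + scaleC ?c y"] S y s(1)
        by (simp add: is_csubspaceD(2,3) diff_diff_eq)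
      then show "\<exists>N. \<forall>n\<ge>N. d \<le> (norm (x - s n - scaleC ?c y))\<^sup>2" by blast
    qed
    also have "\<dots> = (norm (x - m))\<^sup>2 - (cmod (cinner (x - m) y))\<^sup>2 / (norm y)\<^sup>2"
      by (rule norm_minus_component[OF y0])
    finally have "d \<le> (norm (x - m))\<^sup>2 - (cmod (cinner (x - m) y))\<^sup>2 / (norm y)\<^sup>2" .
    moreover have "0 < (cmod (cinner (x - m) y))\<^sup>2 / (norm y)\<^sup>2"
      using nz y0 by simp
    ultimately show False
      using nm by linarith
  qed
  moreover have "m \<in> closure S"
    using m s(1) closure_sequential by blast
  ultimately show thesis
    using that by (auto simp: orth_def)
qed

lemma orth_projection:
  fixes x :: "'a::complex_hilbert"
  assumes "is_csubspace S" "closed S"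
  obtains m where "m \<in> S" "x - m \<in> orth S"
  using orth_projection_closure[OF assms(1), of x] assms(2) by (metis closure_closed)

lemma dense_if_orth_trivial:
  fixes S :: "'a::complex_hilbert set"
  assumes "is_csubspace S" "\<And>x. x \<in> orth S \<Longrightarrow> x = 0"
  shows "closure S = UNIV"
proof -
  have "x \<in> closure S" for x
    using orth_projection_closure[OF assms(1), of x] assms(2) by (metis right_minus_eq)
  then show ?thesis by auto
qed

lemma orth_dense_eq_zero:
  fixes S :: "'a::complex_hilbert set"
  assumes "closure S = UNIV" "x \<in> orth S"
  shows "x = 0"
proof -
  have "S \<subseteq> orth {x}"
    using assms(2) by (auto intro!: orthI dest: orthD(2))
  then have "closure S \<subseteq> orth {x}"
    by (rule closure_minimal[OF _ closed_orth])
  then have "x \<in> orth {x}" using assms(1) by auto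
  then show ?thesis by (auto intro: orth_triv)
qed

text \<open>Sokal's argument: moving by \<open>\<plusminus>3\<^sup>-\<^sup>n\<close> in the direction of the \<open>n\<close>-th vector
  cannot be compensated by all the later, smaller moves.\<close>

lemma cinner_uniform_boundedness:
  fixes S :: "'a::complex_hilbert set"
  assumes bd: "\<And>y. \<exists>C. \<forall>w\<in>S. cmod (cinner w y) \<le> C"
  shows "\<exists>C. \<forall>w\<in>S. norm w \<le> C"
proof (rule ccontr)
  assume unb: "\<nexists>C. \<forall>w\<in>S. norm w \<le> C"
  let ?r = "\<lambda>n. (1/3)^n :: real"
  \<comment> \<open>With this growth, half of \<open>(1/3)^n\<close> times the norm of the
    \<open>n\<close>-th vector is still at least \<open>n\<close>.\<close>
  have "\<exists>w\<in>S. norm w > 2 * real n * 3 ^ n" for n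
    using unb by (meson not_le)
  then obtain w where w: "\<And>n. w n \<in> S" "\<And>n. norm (w n) > 2 * real n * 3 ^ n"
    by metis
  have step: "\<exists>y. norm (y - x) \<le> ?r (Suc n) \<and> ?r (Suc n) * norm (w (Suc n)) \<le> cmod (cinner (w (Suc n)) y)"
    for x n
  proof -
    let ?w = "w (Suc n)"
    define v where "v = scaleR (?r (Suc n) / norm ?w) ?w"
    have w0: "norm ?w > 0"
      by (rule le_less_trans[OF _ w(2)[of "Suc n"]]) simp
    have nv: "norm v = ?r (Suc n)"
      using w0 by (simp add: v_def)
    have "cinner ?w v = of_real (?r (Suc n) / norm ?w * (norm ?w)\<^sup>2)"
      unfolding v_def cinner_scaleR_right cinner_self_norm by simp
    also have "?r (Suc n) / norm ?w * (norm ?w)\<^sup>2 = ?r (Suc n) * norm ?w"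
      using w0 by (simp add: power2_eq_square)
    finally have "cmod (cinner ?w v) = ?r (Suc n) * norm ?w"
      by (metis abs_of_nonneg norm_of_real mult_nonneg_nonneg norm_ge_zero nv)
    \<comment> \<open>The two candidates differ by \<open>2 * cinner ?w v\<close> when paired with
      \<open>?w\<close>, so one of them has a large pairing whatever \<open>x\<close> is.\<close>
    moreover have "cinner ?w (x + v) - cinner ?w (x - v) = 2 * cinner ?w v"
      by (simp add: cinner_simps)
    then have "2 * cmod (cinner ?w v) \<le> cmod (cinner ?w (x + v)) + cmod (cinner ?w (x - v))"
      by (metis norm_mult norm_numeral norm_triangle_ineq4)
    ultimately have "?r (Suc n) * norm ?w \<le> cmod (cinner ?w (x + v)) \<or>
        ?r (Suc n) * norm ?w \<le> cmod (cinner ?w (x - v))"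
      by linarith
    moreover have "norm ((x + v) - x) \<le> ?r (Suc n)" "norm ((x - v) - x) \<le> ?r (Suc n)"
      using nv by auto
    ultimately show ?thesis by blast
  qed
  define Q where "Q = (\<lambda>n x y. norm (y - x) \<le> ?r (Suc n) \<and>
      ?r (Suc n) * norm (w (Suc n)) \<le> cmod (cinner (w (Suc n)) y))"
  obtain x where "\<And>n. Q n (x n) (x (Suc n))"
    using dependent_nat_choice[of "\<lambda>_ _. True" Q] step unfolding Q_def by auto
  then have x: "\<And>n. norm (x (Suc n) - x n) \<le> ?r (Suc n)"
    "\<And>n. ?r (Suc n) * norm (w (Suc n)) \<le> cmod (cinner (w (Suc n)) (x (Suc n)))"
    unfolding Q_def by auto
  \<comment> \<open>Geometric sum: all moves after stage \<open>n\<close> add up to at most half of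
    \<open>(1/3)^n\<close>, hence undo at most half of what stage \<open>n\<close> gained.\<close>
  have dist: "norm (x m - x n) \<le> (?r n - ?r m) / 2" if "n \<le> m" for n m
    using that
  proof (induction m rule: dec_induct)
    case (step m)
    have "norm (x (Suc m) - x n) \<le> norm (x (Suc m) - x m) + norm (x m - x n)"
      using norm_triangle_ineq[of "x (Suc m) - x m" "x m - x n"] by simp
    then show ?case
      using step x(1)[of m] by simp
  qed simp
  have dist': "norm (x m - x n) \<le> ?r n / 2" if "n \<le> m" for n m
    by (rule order_trans[OF dist[OF that]]) simp
  have "Cauchy x"
  proof (rule metric_CauchyI)
    fix e :: real assume "e > 0"
    then obtain N where N: "?r N < e"
      using real_arch_pow_inv[of e "1/3"] by auto
    have "dist (x m) (x n) < e" if "m \<ge> N" "n \<ge> N" for m n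
    proof -
      have "dist (x m) (x n) \<le> dist (x m) (x N) + dist (x n) (x N)"
        by (rule dist_triangle2)
      then show ?thesis
        using dist'[OF that(1)] dist'[OF that(2)] N unfolding dist_norm by linarith
    qed
    then show "\<exists>M. \<forall>m\<ge>M. \<forall>n\<ge>M. dist (x m) (x n) < e" by blast
  qed
  then obtain l where l: "x \<longlonglongrightarrow> l"
    using Cauchy_convergent convergent_def by blast
  have ln: "norm (l - x n) \<le> ?r n / 2" for n
    by (rule LIMSEQ_le_const2[OF tendsto_norm[OF tendsto_diff[OF l tendsto_const]]])
      (use dist' in blast)
  obtain C where C: "\<And>v. v \<in> S \<Longrightarrow> cmod (cinner v l) \<le> C"
    using bd by blast
  obtain n where n: "C < real n"
    using reals_Archimedean2 by blast
  let ?n = "Suc n"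
  have "real ?n \<le> ?r ?n / 2 * norm (w ?n)"
  proof -
    have "?r ?n / 2 * (2 * real ?n * 3 ^ ?n) \<le> ?r ?n / 2 * norm (w ?n)"
      using w(2)[of ?n] by (intro mult_left_mono) auto
    moreover have "?r ?n / 2 * (2 * real ?n * 3 ^ ?n) = real ?n"
      by (simp add: power_divide field_simps)
    ultimately show ?thesis by linarith
  qed
  moreover have "cmod (cinner (w ?n) (x ?n)) \<le> cmod (cinner (w ?n) l) + cmod (cinner (w ?n) (l - x ?n))"
    using norm_triangle_ineq4[of "cinner (w ?n) l" "cinner (w ?n) (l - x ?n)"]
    by (simp add: cinner_diff_right)
  moreover have "cmod (cinner (w ?n) (l - x ?n)) \<le> norm (w ?n) * (?r ?n / 2)"
    by (rule order_trans[OF cinner_Cauchy_Schwarz mult_left_mono[OF ln norm_ge_zero]])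
  ultimately have "real ?n \<le> cmod (cinner (w ?n) l)"
    using x(2)[of n] by (simp add: algebra_simps)
  then show False
    using C[OF w(1)[of ?n]] n by simp
qed

section \<open>Operators\<close>

lemma is_opD:
  assumes "is_op T"
  shows "(0, 0) \<in> T" "(f, g) \<in> T \<Longrightarrow> (f', g') \<in> T \<Longrightarrow> (f + f', g + g') \<in> T"
    "(f, g) \<in> T \<Longrightarrow> (scaleC c f, scaleC c g) \<in> T"
    "(f, g) \<in> T \<Longrightarrow> (f', g') \<in> T \<Longrightarrow> (f - f', g - g') \<in> T"
    "(f, g) \<in> T \<Longrightarrow> (f, g') \<in> T \<Longrightarrow> g = g'"
proof -
  show "(0, 0) \<in> T" "(f, g) \<in> T \<Longrightarrow> (f', g') \<in> T \<Longrightarrow> (f + f', g + g') \<in> T"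
    and sc: "(f, g) \<in> T \<Longrightarrow> (scaleC c f, scaleC c g) \<in> T" for f g f' g' c
    using assms by (auto simp: is_op_def)
  show diff: "(f, g) \<in> T \<Longrightarrow> (f', g') \<in> T \<Longrightarrow> (f - f', g - g') \<in> T" for f g f' g'
  proof -
    assume fg: "(f, g) \<in> T" and "(f', g') \<in> T"
    then have "(- f', - g') \<in> T"
      using sc[of f' g' "- 1"] by (simp add: scaleC_minus_one)
    with fg have "(f + - f', g + - g') \<in> T"
      using assms unfolding is_op_def by blast
    then show ?thesis by simp
  qed
  show "(f, g) \<in> T \<Longrightarrow> (f, g') \<in> T \<Longrightarrow> g = g'"
    using diff[of f g f g'] assms unfolding is_op_def by (metis diff_self right_minus_eq)
qed

lemma op_app_eq: "is_op T \<Longrightarrow> (f, g) \<in> T \<Longrightarrow> op_app T f = g"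
  unfolding op_app_def using is_opD(5) by blast

lemma op_dom_iff: "f \<in> op_dom T \<longleftrightarrow> (\<exists>g. (f, g) \<in> T)"
  unfolding op_dom_def by force

lemma is_csubspace_graph: "is_op T \<Longrightarrow> is_csubspace T"
  by (auto simp: is_csubspace_def is_op_def zero_prod_def scaleC_prod_def)

lemma is_csubspace_op_dom: "is_op T \<Longrightarrow> is_csubspace (op_dom T)"
  unfolding is_csubspace_def Ball_def op_dom_iff by (meson is_opD(1-3))

lemma is_op_op_comp: "is_op S \<Longrightarrow> is_op T \<Longrightarrow> is_op (op_comp S T)"
  unfolding is_op_def op_comp_def by simp metis

lemma adjointD: "(g, h) \<in> adjoint T \<Longrightarrow> (f, k) \<in> T \<Longrightarrow> cinner k g = cinner f h"
  by (simp add: adjoint_def)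

lemma adjointI: "(\<And>f k. (f, k) \<in> T \<Longrightarrow> cinner k g = cinner f h) \<Longrightarrow> (g, h) \<in> adjoint T"
  by (simp add: adjoint_def)

lemma adjointD': "(g, h) \<in> adjoint T \<Longrightarrow> (f, k) \<in> T \<Longrightarrow> cinner g k = cinner h f"
  by (metis adjointD cinner_commute)

lemma is_op_adjoint:
  assumes "densely_defined T"
  shows "is_op (adjoint T)"
proof -
  have "h = 0" if "(0, h) \<in> adjoint T" for h
  proof (rule orth_dense_eq_zero)
    show "closure (op_dom T) = UNIV"
      using assms by (simp add: densely_defined_def)
    show "h \<in> orth (op_dom T)"
      using adjointD[OF that] by (auto intro!: orthI simp: op_dom_iff cinner_eq_zero_commute[of h])
  qed
  then show ?thesis
    by (auto simp: is_op_def adjoint_def cinner_simps)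
qed

text \<open>The adjoint is the orthogonal complement, in the product space, of the graph with each
  \<open>(f, k)\<close> turned into \<open>(k, - f)\<close>; complements are closed.\<close>

lemma closed_adjoint: "closed (adjoint (T :: ('a::complex_hilbert \<times> 'a) set))"
proof -
  have "adjoint T = orth ((\<lambda>(f, k). (k, - f)) ` T)"
  proof -
    have "cinner k g = cinner f h \<longleftrightarrow> cinner g k = cinner h f" for f g h k :: 'a
      by (metis cinner_commute)
    then show ?thesis
      by (auto simp: adjoint_def orth_def cinner_prod_def)
  qed
  then show ?thesis by (simp add: closed_orth)
qed

lemma self_adjointD:
  assumes "self_adjoint A"
  shows "is_op A" "densely_defined A" "closed A"
    "(f, g) \<in> A \<Longrightarrow> (f', g') \<in> A \<Longrightarrow> cinner g f' = cinner f g'"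
    "(\<And>f k. (f, k) \<in> A \<Longrightarrow> cinner k g = cinner f h) \<Longrightarrow> (g, h) \<in> A"
proof -
  show "is_op A" "densely_defined A"
    using assms by (auto simp: self_adjoint_def)
  have A: "adjoint A = A"
    using assms by (simp add: self_adjoint_def)
  then show "closed A"
    by (metis closed_adjoint)
  show "(f, g) \<in> A \<Longrightarrow> (f', g') \<in> A \<Longrightarrow> cinner g f' = cinner f g'" for f' g'
    using A adjointD by blast
  show "(\<And>f k. (f, k) \<in> A \<Longrightarrow> cinner k g = cinner f h) \<Longrightarrow> (g, h) \<in> A"
    using A adjointI by blast
qed

lemma self_adjoint_cinner_real:
  assumes "self_adjoint A" "(f, g) \<in> A"
  shows "Im (cinner g f) = 0"
proof -
  have "cinner g f = cnj (cinner g f)"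
    using self_adjointD(4)[OF assms(1,2,2)] cinner_commute by metis
  then show ?thesis by (metis Im_complex_of_real Reals_cnj_iff complex_is_Real_iff)
qed

lemma closed_op_limit:
  assumes "closed T" "\<And>n. (f n, g n) \<in> T" "f \<longlonglongrightarrow> x" "g \<longlonglongrightarrow> y"
  shows "(x, y) \<in> T"
proof -
  have "(\<lambda>n. (f n, g n)) \<longlonglongrightarrow> (x, y)"
    by (intro tendsto_Pair assms)
  then show ?thesis
    by (rule closed_sequentially[OF assms(1), rotated]) (fact assms(2))
qed

section \<open>Surjectivity, resolvents and self-adjointness criteria\<close>

lemma Cauchy_if_norm_le:
  fixes f :: "nat \<Rightarrow> 'a::complex_hilbert" and g :: "nat \<Rightarrow> 'b::complex_hilbert"
  assumes "Cauchy g" "c > 0" "\<And>m n. c * norm (f m - f n) \<le> norm (g m - g n)"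
  shows "Cauchy f"
proof (rule metric_CauchyI)
  fix e :: real assume "e > 0"
  then obtain M where M: "\<And>m n. m \<ge> M \<Longrightarrow> n \<ge> M \<Longrightarrow> dist (g m) (g n) < c * e"
    using metric_CauchyD[OF assms(1), of "c * e"] assms(2) by auto
  have "dist (f m) (f n) < e" if "m \<ge> M" "n \<ge> M" for m n
  proof -
    have "c * norm (f m - f n) < c * e"
      using assms(3)[of m n] M[OF that] by (simp add: dist_norm)
    then show ?thesis using assms(2) by (simp add: dist_norm)
  qed
  then show "\<exists>M. \<forall>m\<ge>M. \<forall>n\<ge>M. dist (f m) (f n) < e" by blast
qed

text \<open>The first lower bound makes the range of \<open>A - z\<close> closed; a vector
  orthogonal to it is in the kernel of \<open>A - cnj z\<close>, which the second bound makes
  trivial. A general \<open>z\<close> serves both nonreal \<open>z\<close> and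
  \<open>z = - a\<close> for nonnegative \<open>A\<close>.\<close>

lemma self_adjoint_minus_scalar_surj:
  assumes A: "self_adjoint A" and c: "c > 0"
    and low: "\<And>f g. (f, g) \<in> A \<Longrightarrow> c * norm f \<le> norm (g - scaleC z f)"
    and low': "\<And>f g. (f, g) \<in> A \<Longrightarrow> c * norm f \<le> norm (g - scaleC (cnj z) f)"
  shows "\<exists>f. (f, h + scaleC z f) \<in> A"
proof -
  let ?S = "{g - scaleC z f | f g. (f, g) \<in> A}"
  note opA = is_opD[OF self_adjointD(1)[OF A]]
  have S: "is_csubspace ?S"
    unfolding is_csubspace_def
  proof (intro conjI ballI allI)
    show "0 \<in> ?S" using opA(1) by (auto intro!: exI[of _ 0])
    show "x + y \<in> ?S" if "x \<in> ?S" "y \<in> ?S" for x y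
    proof -
      from that obtain f g f' g' where "(f, g) \<in> A" "(f', g') \<in> A"
        "x = g - scaleC z f" "y = g' - scaleC z f'" by blast
      then show ?thesis
        using opA(2)[of f g f' g']
        by (intro CollectI exI[of _ "f + f'"] exI[of _ "g + g'"]) (simp add: scaleC_add_right)
    qed
    show "scaleC d x \<in> ?S" if "x \<in> ?S" for x d
    proof -
      from that obtain f g where "(f, g) \<in> A" "x = g - scaleC z f" by blast
      then show ?thesis
        using opA(3)[of f g d]
        by (intro CollectI exI[of _ "scaleC d f"] exI[of _ "scaleC d g"])
          (simp add: scaleC_diff_right scaleC_scaleC mult.commute)
    qed
  qed
  have "closed ?S"
    unfolding closed_sequential_limits
  proof (intro allI impI, elim conjE)
    fix s l assume s: "\<forall>n. s n \<in> ?S" and l: "s \<longlonglongrightarrow> l"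
    have "\<exists>f. (f, s n + scaleC z f) \<in> A" for n
    proof -
      obtain f g where "s n = g - scaleC z f" "(f, g) \<in> A"
        using s by blast
      then show ?thesis by (intro exI[of _ f]) simp
    qed
    then obtain f where f: "\<And>n. (f n, s n + scaleC z (f n)) \<in> A" by metis
    have "Cauchy f"
    proof (rule Cauchy_if_norm_le[OF LIMSEQ_imp_Cauchy[OF l] c])
      fix m n
      have "c * norm (f m - f n) \<le>
        norm ((s m + scaleC z (f m)) - (s n + scaleC z (f n)) - scaleC z (f m - f n))"
        by (rule low[OF opA(4)[OF f f]])
      then show "c * norm (f m - f n) \<le> norm (s m - s n)"
        by (simp add: scaleC_diff_right)
    qed
    then obtain x where x: "f \<longlonglongrightarrow> x"
      using Cauchy_convergent convergent_def by blast
    have "(x, l + scaleC z x) \<in> A"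
      by (rule closed_op_limit[OF self_adjointD(3)[OF A] f x])
        (intro tendsto_add l tendsto_scaleC x)
    then show "l \<in> ?S" by force
  qed
  then obtain m where m: "m \<in> ?S" "h - m \<in> orth ?S"
    using orth_projection[OF S] by blast
  let ?k = "h - m"
  have "(?k, scaleC (cnj z) ?k) \<in> A"
  proof (rule self_adjointD(5)[OF A])
    fix f g assume "(f, g) \<in> A"
    then have "cinner (g - scaleC z f) ?k = 0"
      by (intro orthD(2)[OF m(2)]) blast
    then show "cinner g ?k = cinner f (scaleC (cnj z) ?k)"
      by (simp add: cinner_diff_left cinner_scaleC_left cinner_scaleC_right)
  qed
  from low'[OF this] have hm: "h = m"
    using c by (simp add: mult_le_0_iff)
  obtain f g where "m = g - scaleC z f" "(f, g) \<in> A"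
    using m(1) by blast
  then show ?thesis unfolding hm by (intro exI[of _ f]) simp
qed

text \<open>As \<open>cinner g f\<close> is real, the imaginary part of
  \<open>cinner (g - scaleC z f) f\<close> is exactly \<open>- Im z * (norm f)\<^sup>2\<close>;
  Cauchy-Schwarz does the rest.\<close>

lemma self_adjoint_lower_bound_Im:
  assumes "self_adjoint A" "(f, g) \<in> A"
  shows "\<bar>Im z\<bar> * norm f \<le> norm (g - scaleC z f)"
proof (cases "f = 0")
  case False
  have "Im (cinner (g - scaleC z f) f) = - Im z * (norm f)\<^sup>2"
    using self_adjoint_cinner_real[OF assms]
    by (simp add: cinner_diff_left cinner_scaleC_left cinner_self_norm flip: of_real_power)
  then have "\<bar>Im z\<bar> * (norm f)\<^sup>2 = \<bar>Im (cinner (g - scaleC z f) f)\<bar>"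
    by (simp add: abs_mult)
  also have "\<dots> \<le> norm (g - scaleC z f) * norm f"
    using abs_Im_le_cmod cinner_Cauchy_Schwarz order_trans by blast
  finally show ?thesis
    using False by (simp add: power2_eq_square flip: mult.assoc)
qed simp

lemma self_adjoint_nonreal_surj:
  assumes "self_adjoint A" "Im z \<noteq> 0"
  shows "\<exists>f. (f, h + scaleC z f) \<in> A"
  using self_adjoint_lower_bound_Im[OF assms(1), of _ _ z]
    self_adjoint_lower_bound_Im[OF assms(1), of _ _ "cnj z"] assms
  by (intro self_adjoint_minus_scalar_surj[of _ "\<bar>Im z\<bar>"]) auto

lemma nonneg_lower_bound:
  assumes "nonneg_op A" "(f, g) \<in> A"
  shows "a * norm f \<le> norm (g + scaleR a f)"
proof (cases "f = 0")
  case False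
  have "Re (cinner (g + scaleR a f) f) = Re (cinner g f) + a * (norm f)\<^sup>2"
    by (simp add: cinner_add_left cinner_scaleR_left cinner_self_norm flip: of_real_power)
  moreover have "0 \<le> Re (cinner g f)"
    using assms by (auto simp: nonneg_op_def)
  ultimately have "a * (norm f)\<^sup>2 \<le> norm (g + scaleR a f) * norm f"
    using complex_Re_le_cmod[of "cinner (g + scaleR a f) f"] cinner_Cauchy_Schwarz[of "g + scaleR a f" f]
    by linarith
  then show ?thesis
    using False by (simp add: power2_eq_square flip: mult.assoc)
qed simp

text \<open>Surjectivity at \<open>z = - a\<close> provides a solution and
  \<open>nonneg_lower_bound\<close> its uniqueness, so the \<open>THE\<close> in
  \<open>op_resolvent\<close> is well defined.\<close>

lemma nonneg_self_adjoint_resolvent: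
  assumes A: "self_adjoint A" "nonneg_op A" and a: "a > 0"
  shows "(op_resolvent A a h, h - scaleR a (op_resolvent A a h)) \<in> A"
proof -
  have sc: "scaleC (complex_of_real (- a)) f = - scaleR a f" for f :: 'a
    by (simp add: scaleC_minus_left flip: scaleR_scaleC)
  have low: "a * norm f \<le> norm (g - scaleC (complex_of_real (- a)) f)" if "(f, g) \<in> A" for f g
    unfolding sc using nonneg_lower_bound[OF A(2) that, of a] by simp
  obtain f where "(f, h + scaleC (complex_of_real (- a)) f) \<in> A"
    using self_adjoint_minus_scalar_surj[OF A(1) a low, of h] low by auto
  then have f: "(f, h - scaleR a f) \<in> A"
    unfolding sc by simp
  have "op_resolvent A a h = f"
    unfolding op_resolvent_def
  proof (rule the_equality)
    show "(f, h) \<in> op_shift A a"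
      unfolding op_shift_def using f by force
    fix f' assume "(f', h) \<in> op_shift A a"
    then have "(f', h - scaleR a f') \<in> A"
      by (auto simp: op_shift_def)
    from nonneg_lower_bound[OF A(2) is_opD(4)[OF self_adjointD(1)[OF A(1)] this f], of a]
    show "f' = f"
      using a by (simp add: algebra_simps mult_le_0_iff)
  qed
  with f show ?thesis by simp
qed

text \<open>The assumption \<open>surj\<close> says that \<open>K + I\<close> is onto. For a
  symmetric nonnegative \<open>K\<close> this yields both the density of the domain and the
  inclusion of the adjoint in \<open>K\<close>.\<close>

lemma self_adjoint_if_surj:
  assumes K: "is_op K"
    and sym: "\<And>f g f' g'. (f, g) \<in> K \<Longrightarrow> (f', g') \<in> K \<Longrightarrow> cinner g f' = cinner f g'"
    and surj: "\<And>h. \<exists>f. (f, h - f) \<in> K"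
    and nonneg: "nonneg_op K"
  shows "self_adjoint K"
  unfolding self_adjoint_def
proof (intro conjI)
  show "densely_defined K"
    unfolding densely_defined_def
  proof (rule dense_if_orth_trivial[OF is_csubspace_op_dom[OF K]])
    fix u assume u: "u \<in> orth (op_dom K)"
    \<comment> \<open>Here \<open>u = (K + I) f\<close>. Orthogonality of \<open>u\<close> to
      \<open>f\<close> gives \<open>(K f, f)\<close> the value \<open>- (norm f)\<^sup>2\<close>,
      which nonnegativity allows only for \<open>f = 0\<close>.\<close>
    obtain f where f: "(f, u - f) \<in> K" using surj by blast
    then have "cinner u f = 0"
      using orthD(1)[OF u] by (auto simp: op_dom_iff)
    then have "Re (cinner (u - f) f) = - (norm f)\<^sup>2"
      by (simp add: cinner_diff_left Re_cinner_self)
    moreover have "0 \<le> Re (cinner (u - f) f)"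
      using nonneg f by (auto simp: nonneg_op_def)
    ultimately have "f = 0" by simp
    then show "u = 0"
      using f is_opD(5)[OF K _ is_opD(1)[OF K]] by auto
  qed
  show "adjoint K = K"
  proof (intro equalityI subsetI)
    fix p assume "p \<in> adjoint K"
    then obtain g h where p: "p = (g, h)" and gh: "(g, h) \<in> adjoint K"
      by (cases p) auto
    \<comment> \<open>The vector \<open>x = (K + I)^-1 (h + g)\<close> is the one that should equal
      \<open>g\<close>. With \<open>y = (K + I)^-1 (g - x)\<close>, testing the adjoint relation and
      symmetry against \<open>y\<close> shows that \<open>g - x\<close> is orthogonal to
      itself.\<close>
    obtain x where x: "(x, h + g - x) \<in> K" using surj by blast
    obtain y where y: "(y, g - x - y) \<in> K" using surj by blast
    have "cinner (g - x) (g - x) = 0"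
      using adjointD[OF gh y] sym[OF y x] by (simp add: cinner_simps algebra_simps)
    then show "p \<in> K"
      using x p by simp
  qed (use sym in \<open>auto intro: adjointI\<close>)
qed (fact K)

text \<open>Von Neumann's theorem. Moving \<open>T\<close> across the inner product leaves
  \<open>(T* x, T* x')\<close>, whence symmetry and nonnegativity; what remains is to solve
  \<open>f + T T* f = h\<close>.\<close>

lemma op_comp_adjoint_nonneg_self_adjoint:
  assumes T: "closed_op T" "densely_defined T"
  shows "self_adjoint (op_comp T (adjoint T))" "nonneg_op (op_comp T (adjoint T))"
proof -
  have opT: "is_op T" "closed T"
    using T by (auto simp: closed_op_def)
  have inner: "cinner l x' = cinner k k'" "cinner x' l = cinner k' k"
    if "(x, k) \<in> adjoint T" "(k, l) \<in> T" "(x', k') \<in> adjoint T" for x k l x' k'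
    using adjointD[OF that(3,2)] adjointD'[OF that(3,2)] .
  show nonneg: "nonneg_op (op_comp T (adjoint T))"
    unfolding nonneg_op_def op_comp_def using inner(1) by (auto simp: cinner_self_norm)
  show "self_adjoint (op_comp T (adjoint T))"
  proof (rule self_adjoint_if_surj[OF _ _ _ nonneg])
    show "is_op (op_comp T (adjoint T))"
      by (intro is_op_op_comp opT is_op_adjoint T)
    show "cinner g f' = cinner f g'"
      if "(f, g) \<in> op_comp T (adjoint T)" "(f', g') \<in> op_comp T (adjoint T)" for f g f' g'
      using that unfolding op_comp_def by (auto simp: inner)
    show "\<exists>f. (f, h - f) \<in> op_comp T (adjoint T)" for h
    proof -
      \<comment> \<open>decompose \<open>(0, h)\<close> along the graph of \<open>T\<close> and its orthogonal complement\<close>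
      obtain m where m: "m \<in> T" "(0, h) - m \<in> orth T"
        using orth_projection[OF is_csubspace_graph[OF opT(1)] opT(2)] by blast
      obtain k l where kl: "m = (k, l)" by (cases m)
      have "(h - l, k) \<in> adjoint T"
      proof (rule adjointI)
        fix f g assume "(f, g) \<in> T"
        from orthD(2)[OF m(2) this] show "cinner g (h - l) = cinner f k"
          by (simp add: kl cinner_prod_def)
      qed
      then show ?thesis
        using m(1) kl unfolding op_comp_def by (intro exI[of _ "h - l"]) auto
    qed
  qed
qed

section \<open>Subspaces transversal to the domain\<close>

locale self_adjoint_op =
  fixes B :: "('h::complex_hilbert \<times> 'h) set"
  assumes sa: "self_adjoint B"
begin

lemmas B_op = is_opD[OF self_adjointD(1)[OF sa]]
lemmas closed_B = self_adjointD(3)[OF sa]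
lemmas B_sym = self_adjointD(4)[OF sa]
lemmas in_BI = self_adjointD(5)[OF sa]

text \<open>\<open>R = (B - \<i>)\<inverse>\<close> and \<open>R' = (B + \<i>)\<inverse> = R\<^sup>*\<close>.\<close>

definition R :: "'h \<Rightarrow> 'h" where "R h = (SOME f. (f, h + scaleC \<i> f) \<in> B)"
definition R' :: "'h \<Rightarrow> 'h" where "R' h = (SOME f. (f, h - scaleC \<i> f) \<in> B)"

lemma R_graph: "(R h, h + scaleC \<i> (R h)) \<in> B"
  unfolding R_def by (rule someI_ex) (simp add: self_adjoint_nonreal_surj[OF sa])

lemma R'_graph: "(R' h, h - scaleC \<i> (R' h)) \<in> B"
proof -
  have "\<exists>f. (f, h - scaleC \<i> f) \<in> B"
    using self_adjoint_nonreal_surj[OF sa, of "- \<i>" h] by (simp add: scaleC_minus_left)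
  then show ?thesis
    unfolding R'_def by (rule someI_ex)
qed

lemma norm_le_minus_i: "(f, g) \<in> B \<Longrightarrow> norm f \<le> norm (g - scaleC \<i> f)"
  using self_adjoint_lower_bound_Im[OF sa, of f g \<i>] by simp

lemma R_eqI: "(f, h + scaleC \<i> f) \<in> B \<Longrightarrow> R h = f"
  using norm_le_minus_i[OF B_op(4)[OF _ R_graph[of h]], of f "h + scaleC \<i> f"]
  by (simp add: scaleC_diff_right algebra_simps)

lemma R_minus_i: "(f, g) \<in> B \<Longrightarrow> R (g - scaleC \<i> f) = f"
  by (rule R_eqI) simp

lemma R'_dom: "R' x \<in> op_dom B"
  using R'_graph by (auto simp: op_dom_iff)

lemma R_add: "R (x + y) = R x + R y"
  using B_op(2)[OF R_graph[of x] R_graph[of y]]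
  by (intro R_eqI) (simp add: scaleC_add_right algebra_simps)

lemma R_scaleC: "R (scaleC c x) = scaleC c (R x)"
  using B_op(3)[OF R_graph[of x], of c]
  by (intro R_eqI) (simp add: scaleC_add_right scaleC_scaleC mult.commute)

lemma R_minus: "R (- x) = - R x"
  using R_scaleC[of "- 1" x] by (simp add: scaleC_minus_one)

lemma R_diff: "R (x - y) = R x - R y"
  using R_add[of x "- y"] by (simp add: R_minus)

lemma R_zero [simp]: "R 0 = 0"
  using R_scaleC[of 0 0] by simp

lemma norm_R: "norm (R x) \<le> norm x"
  using norm_le_minus_i[OF R_graph[of x]] by simp

lemma inj_R: "R x = R y \<Longrightarrow> x = y"
  using B_op(5)[OF R_graph[of x], of "y + scaleC \<i> (R y)"] R_graph[of y] by simp

lemma cinner_R: "cinner (R x) y = cinner x (R' y)"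
  using B_sym[OF R_graph[of x] R'_graph[of y]] by (simp add: cinner_simps algebra_simps)

lemma inj_R': "R' y = 0 \<Longrightarrow> y = 0"
  using B_op(5)[OF _ B_op(1), of "y - scaleC \<i> (R' y)"] R'_graph[of y] by simp

lemma dom_eq_R': "y \<in> op_dom B \<Longrightarrow> \<exists>x. y = R' x"
proof -
  assume "y \<in> op_dom B"
  then obtain g where g: "(y, g) \<in> B" by (auto simp: op_dom_iff)
  let ?x = "g + scaleC \<i> y"
  have "(R' ?x - y, scaleC (- \<i>) (R' ?x - y)) \<in> B"
    using B_op(4)[OF R'_graph[of ?x] g] by (simp add: scaleC_diff_right scaleC_minus_left)
  from self_adjoint_lower_bound_Im[OF sa this, of "- \<i>"] have "R' ?x = y"
    by simp
  then show ?thesis by metis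
qed

lemma dom_eq_R: "y \<in> op_dom B \<Longrightarrow> \<exists>x. y = R x"
  using R_minus_i by (metis op_dom_iff)

lemma is_csubspace_image_R: "is_csubspace M \<Longrightarrow> is_csubspace (R ` M)"
  unfolding is_csubspace_def by (auto simp flip: R_add R_scaleC intro: image_eqI[of _ _ 0])

text \<open>Since \<open>R'\<close> is the adjoint of \<open>R\<close>, a vector \<open>x\<close> is
  orthogonal to the image of \<open>M\<close> exactly when \<open>R' x\<close> is orthogonal to
  \<open>M\<close>, and \<open>R' x\<close> always lies in the domain of \<open>B\<close>.\<close>

lemma dense_image_R:
  assumes M: "is_csubspace M" "orth M \<inter> op_dom B \<subseteq> {0}"
  shows "closure (R ` M) = UNIV"
proof (rule dense_if_orth_trivial[OF is_csubspace_image_R[OF M(1)]])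
  fix x assume x: "x \<in> orth (R ` M)"
  have "R' x \<in> orth M"
    using orthD(2)[OF x] by (auto intro!: orthI simp: cinner_eq_zero_commute[of "R' x"] simp flip: cinner_R)
  with M(2) R'_dom have "R' x = 0" by auto
  then show "x = 0" by (rule inj_R')
qed

text \<open>Invariant kept while vectors are chosen one by one. For a subspace the double-complement
  clause amounts to closedness, in a form that is easy to check after adjoining one vector.\<close>

definition admissible :: "'h set \<Rightarrow> bool" where
  "admissible F \<longleftrightarrow> is_csubspace F \<and> orth (orth F) \<subseteq> F \<and> F \<inter> op_dom B \<subseteq> {0}"

text \<open>The double-complement clause lets the notion pass from \<open>M\<close> to
  \<open>orth M\<close>.\<close>

definition transversal :: "'h set \<Rightarrow> bool" where
  "transversal M \<longleftrightarrow> is_csubspace M \<and> closed M \<and> orth (orth M) \<subseteq> M \<and>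
     M \<inter> op_dom B \<subseteq> {0} \<and> orth M \<inter> op_dom B \<subseteq> {0}"

end

section \<open>Inductive construction of transversal subspaces\<close>

locale unbounded_self_adjoint_op = self_adjoint_op +
  assumes ub: "unbounded_op B"
begin

text \<open>If the sum were everything, uniform boundedness would bound \<open>R\<close> from below
  on \<open>orth F\<close>. The image of \<open>orth F\<close> is dense, so the bound would extend
  to the whole space and make \<open>B\<close> bounded.\<close>

lemma set_sum_op_dom_ne_UNIV:
  assumes F: "admissible F"
  shows "\<exists>y. y \<notin> set_sum F (op_dom B)"
proof (rule ccontr)
  assume "\<not> ?thesis"
  then have all: "\<And>y. y \<in> set_sum F (op_dom B)" by blast
  \<comment> \<open>For \<open>y = f + R' x\<close> with \<open>f\<close> in \<open>F\<close>, such
    an \<open>s\<close> gives \<open>cinner s y = cinner (R s) x\<close>, which is bounded by the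
    norm of \<open>x\<close>.\<close>
  let ?S = "{s \<in> orth F. norm (R s) \<le> 1}"
  have "\<exists>C. \<forall>s\<in>?S. norm s \<le> C"
  proof (rule cinner_uniform_boundedness)
    fix y
    obtain f x where y: "y = f + R' x" "f \<in> F"
      using all[of y] dom_eq_R' unfolding set_sum_def by blast
    have "cmod (cinner s y) \<le> norm x" if s: "s \<in> ?S" for s
    proof -
      have "cinner s y = cinner (R s) x"
        using orthD(1)[of s F f] s y by (simp add: cinner_R cinner_add_right)
      also have "cmod \<dots> \<le> norm (R s) * norm x"
        by (rule cinner_Cauchy_Schwarz)
      also have "\<dots> \<le> 1 * norm x"
        using s by (intro mult_right_mono) auto
      finally show ?thesis by simp
    qed
    then show "\<exists>C. \<forall>s\<in>?S. cmod (cinner s y) \<le> C" by blast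
  qed
  then obtain C0 where "\<And>s. s \<in> ?S \<Longrightarrow> norm s \<le> C0" by blast
  then obtain C where C: "\<And>s. s \<in> ?S \<Longrightarrow> norm s \<le> C" and C0: "C > 0"
    by (metis dual_order.trans gt_ex linear max.cobounded1 max.cobounded2 less_max_iff_disj zero_less_one)
  have bound: "norm s \<le> C * norm (R s)" if s: "s \<in> orth F" for s
  proof (cases "s = 0")
    case False
    then have n0: "norm (R s) > 0"
      using inj_R[of s 0] by auto
    have "scaleC (of_real (inverse (norm (R s)))) s \<in> ?S"
      using s n0 is_csubspaceD(3)[OF is_csubspace_orth] by (auto simp: R_scaleC norm_scaleC norm_inverse)
    from C[OF this] have "inverse (norm (R s)) * norm s \<le> C"
      by (simp add: norm_scaleC norm_inverse)
    then show ?thesis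
      using n0 by (simp add: field_simps)
  qed simp
  have "closure (R ` orth F) = UNIV"
    using F is_csubspace_orth by (intro dense_image_R) (auto simp: admissible_def)
  \<comment> \<open>By \<open>bound\<close> the preimages of an approximating sequence converge, and
    the closed graph then puts every \<open>x\<close> into the domain with the same
    estimate.\<close>
  have all_bounded: "\<exists>g. (x, g) \<in> B \<and> norm (g - scaleC \<i> x) \<le> C * norm x" for x
  proof -
    have "x \<in> closure (R ` orth F)"
      using \<open>closure (R ` orth F) = UNIV\<close> by simp
    then obtain t where t: "\<And>n. t n \<in> R ` orth F" "t \<longlonglongrightarrow> x"
      unfolding closure_sequential by blast
    then obtain s where s: "\<And>n. s n \<in> orth F" "\<And>n. t n = R (s n)"
      unfolding image_iff by metis
    have "Cauchy s"
    proof (rule Cauchy_if_norm_le[OF LIMSEQ_imp_Cauchy[OF t(2)]])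
      show "inverse C > 0" using C0 by simp
      fix m n
      have "norm (s m - s n) \<le> C * norm (R (s m - s n))"
        using s(1) is_csubspace_orth is_csubspaceD(5) by (intro bound) blast
      then show "inverse C * norm (s m - s n) \<le> norm (t m - t n)"
        using C0 by (simp add: R_diff s(2) field_simps)
    qed
    then obtain l where l: "s \<longlonglongrightarrow> l"
      using Cauchy_convergent convergent_def by blast
    have "(x, l + scaleC \<i> x) \<in> B"
    proof (rule closed_op_limit[OF closed_B _ t(2)])
      show "(t n, s n + scaleC \<i> (t n)) \<in> B" for n
        using R_graph s(2) by simp
      show "(\<lambda>n. s n + scaleC \<i> (t n)) \<longlonglongrightarrow> l + scaleC \<i> x"
        by (intro tendsto_add l tendsto_scaleC t)
    qed
    moreover have "norm l \<le> C * norm x"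
    proof (rule LIMSEQ_le)
      show "(\<lambda>n. norm (s n)) \<longlonglongrightarrow> norm l" "(\<lambda>n. C * norm (t n)) \<longlonglongrightarrow> C * norm x"
        by (intro tendsto_intros l t)+
      show "\<exists>N. \<forall>n\<ge>N. norm (s n) \<le> C * norm (t n)"
        using bound[OF s(1)] s(2) by simp
    qed
    ultimately show ?thesis by (intro exI[of _ "l + scaleC \<i> x"]) simp
  qed
  have "norm g \<le> (C + 1) * norm f" if "(f, g) \<in> B" for f g
  proof -
    have "norm (g - scaleC \<i> f) \<le> C * norm f"
      using all_bounded[of f] B_op(5)[OF that] by blast
    then show ?thesis
      using norm_triangle_ineq[of "g - scaleC \<i> f" "scaleC \<i> f"]
      by (simp add: norm_scaleC algebra_simps)
  qed
  then show False
    using ub unfolding unbounded_op_def by blast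
qed

text \<open>Density supplies an approximation of \<open>d\<close> from \<open>orth F\<close>; if it
  happens to lie in the forbidden sum, a small multiple of a vector outside that sum pushes it
  out.\<close>

lemma admissible_step:
  assumes F: "admissible F" and e: "e > 0"
  obtains w where "w \<in> orth F" "w \<notin> set_sum F (op_dom B)" "norm (R w - d) < e"
proof -
  have F': "is_csubspace F" "orth (orth F) \<subseteq> F" "F \<inter> op_dom B \<subseteq> {0}"
    using F by (auto simp: admissible_def)
  note sub = is_csubspaceD[OF F'(1)] and dom = is_csubspaceD[OF is_csubspace_op_dom[OF self_adjointD(1)[OF sa]]]
    and oF = is_csubspaceD[OF is_csubspace_orth[of F]]
  have sums: "x - y \<in> set_sum F (op_dom B)" "scaleC c x \<in> set_sum F (op_dom B)"
    if x: "x \<in> set_sum F (op_dom B)" and y: "y \<in> set_sum F (op_dom B)" for x y c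
  proof -
    obtain a b where x: "x = a + b" "a \<in> F" "b \<in> op_dom B" using x by (auto simp: set_sum_def)
    obtain a' b' where y: "y = a' + b'" "a' \<in> F" "b' \<in> op_dom B" using y by (auto simp: set_sum_def)
    have "x - y = (a - a') + (b - b')" "scaleC c x = scaleC c a + scaleC c b"
      using x y by (simp_all add: scaleC_add_right)
    then show "x - y \<in> set_sum F (op_dom B)" "scaleC c x \<in> set_sum F (op_dom B)"
      unfolding set_sum_def using x y sub(3,5) dom(3,5) by blast+
  qed
  obtain y0 where y0: "y0 \<notin> set_sum F (op_dom B)"
    using set_sum_op_dom_ne_UNIV[OF F] by blast
  have "F = orth (orth F)"
    using F'(2) by (auto intro: orthI orthD(2))
  then have "closed F"
    by (metis closed_orth)
  then obtain m where m: "m \<in> F" "y0 - m \<in> orth F"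
    using orth_projection[OF F'(1)] by blast
  \<comment> \<open>Removing the component in \<open>F\<close> makes the vector orthogonal to
    \<open>F\<close> and cannot bring it into the sum.\<close>
  define y where "y = y0 - m"
  have y: "y \<in> orth F" "y \<notin> set_sum F (op_dom B)"
  proof -
    show "y \<in> orth F" using m by (simp add: y_def)
    have m': "- m \<in> set_sum F (op_dom B)"
      using m sub(4) dom(1) unfolding set_sum_def by force
    show "y \<notin> set_sum F (op_dom B)"
      using sums(1)[OF _ m', of y] y0 by (auto simp: y_def)
  qed
  have "closure (R ` orth F) = UNIV"
    using F' is_csubspace_orth by (intro dense_image_R) auto
  then obtain w0 where w0: "w0 \<in> orth F" "norm (R w0 - d) < e / 2"
    using closure_approachable[of d "R ` orth F"] e by (auto simp: dist_norm dest!: spec[of _ "e / 2"])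
  show thesis
  proof (cases "w0 \<in> set_sum F (op_dom B)")
    case False
    with w0 e show thesis by (intro that[of w0]) auto
  next
    case True
    \<comment> \<open>The \<open>+ 1\<close> keeps the denominator positive and makes the estimate
      of \<open>r * norm y\<close> strict.\<close>
    define q where "q = norm y + 1"
    define r where "r = e / (2 * q)"
    have r: "r > 0" "r * norm y < e / 2"
    proof -
      have p: "q > 0" by (simp add: q_def add_nonneg_pos)
      then show "r > 0" using e by (simp add: r_def)
      then have "r * norm y < r * q" by (simp add: q_def)
      also have "\<dots> = e / 2" using p by (simp add: r_def)
      finally show "r * norm y < e / 2" .
    qed
    define w where "w = w0 - scaleC (of_real r) y"
    show thesis
    proof (rule that)
      show "w \<in> orth F"
        unfolding w_def by (intro oF(5) oF(3) w0 y)
      show "w \<notin> set_sum F (op_dom B)"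
      proof
        assume "w \<in> set_sum F (op_dom B)"
        from sums(1)[OF True this] have "scaleC (of_real r) y \<in> set_sum F (op_dom B)"
          by (simp add: w_def)
        from sums(2)[OF this this, of "inverse (of_real r)"] show False
          using y(2) r(1) by (simp add: scaleC_scaleC scaleC_one)
      qed
      have "R w - d = (R w0 - d) - R (scaleC (of_real r) y)"
        by (simp add: w_def R_diff)
      also have "norm \<dots> \<le> norm (R w0 - d) + norm (scaleC (of_real r) y)"
        using norm_triangle_ineq4[of "R w0 - d" "R (scaleC (of_real r) y)"]
          norm_R[of "scaleC (of_real r) y"] by linarith
      finally show "norm (R w - d) < e"
        using w0 r by (simp add: norm_scaleC)
    qed
  qed
qed

text \<open>Orthogonality of \<open>w\<close> to \<open>F\<close> lets the double complement be
  checked by splitting off components along \<open>w\<close>; \<open>w\<close> being outside the sum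
  keeps new combinations out of the domain.\<close>

lemma admissible_extend:
  assumes F: "admissible F" and w: "w \<in> orth F" "w \<notin> set_sum F (op_dom B)"
  shows "admissible {a + scaleC c w | a c. a \<in> F}" (is "admissible ?F")
proof -
  have F': "is_csubspace F" "orth (orth F) \<subseteq> F" "F \<inter> op_dom B \<subseteq> {0}"
    using F by (auto simp: admissible_def)
  note sub = is_csubspaceD[OF F'(1)] and dom = is_csubspaceD[OF is_csubspace_op_dom[OF self_adjointD(1)[OF sa]]]
  have w0: "w \<noteq> 0"
    using w(2) sub(1) dom(1) unfolding set_sum_def by force
  have inF: "a + scaleC c w \<in> ?F" if "a \<in> F" for a c
    using that by blast
  have "is_csubspace ?F"
    unfolding is_csubspace_def
  proof (intro conjI ballI allI)
    show "0 \<in> ?F" using inF[OF sub(1), of 0] by simp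
    show "x + y \<in> ?F" if "x \<in> ?F" "y \<in> ?F" for x y
    proof -
      from that obtain a c a' c' where "a \<in> F" "a' \<in> F" "x = a + scaleC c w" "y = a' + scaleC c' w" by blast
      then show ?thesis
        using inF[of "a + a'" "c + c'"] sub(2) by (simp add: scaleC_add_left algebra_simps)
    qed
    show "scaleC d x \<in> ?F" if "x \<in> ?F" for x d
    proof -
      from that obtain a c where "a \<in> F" "x = a + scaleC c w" by blast
      then show ?thesis
        using inF[of "scaleC d a" "d * c"] sub(3) by (simp add: scaleC_add_right scaleC_scaleC)
    qed
  qed
  moreover have "orth (orth ?F) \<subseteq> ?F"
  proof
    fix x assume x: "x \<in> orth (orth ?F)"
    let ?n = "of_real ((norm w)\<^sup>2) :: complex"
    have n0: "?n \<noteq> 0" using w0 by simp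
    define c where "c = cinner x w / ?n"
    have xw: "cinner (x - scaleC c w) w = 0"
      using n0 by (simp add: c_def cinner_simps cinner_self_norm)
    have "x - scaleC c w \<in> orth (orth F)"
    proof (rule orthI)
      fix y assume y: "y \<in> orth F"
      \<comment> \<open>Dropping the component along \<open>w\<close> turns \<open>y\<close> into a
        vector orthogonal to the whole enlarged space, against which \<open>x\<close> can be
        tested.\<close>
      define y' where "y' = y - scaleC (cinner y w / ?n) w"
      have y'w: "cinner y' w = 0"
        using n0 by (simp add: y'_def cinner_simps cinner_self_norm)
      have "y' \<in> orth ?F"
      proof (rule orthI)
        fix z assume "z \<in> ?F"
        then obtain a d where z: "z = a + scaleC d w" "a \<in> F" by blast
        have "cinner y' a = 0"
          using orthD(1)[OF y z(2)] orthD(1)[OF w(1) z(2)] by (simp add: y'_def cinner_simps)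
        then show "cinner y' z = 0"
          using z y'w by (simp add: cinner_simps)
      qed
      then have "cinner x y' = 0"
        by (rule orthD(1)[OF x])
      moreover have "cinner w y' = 0"
        using y'w by (simp add: cinner_eq_zero_commute[of w])
      ultimately have "cinner (x - scaleC c w) y' = 0"
        by (simp add: cinner_simps)
      moreover have "y = y' + scaleC (cinner y w / ?n) w"
        by (simp add: y'_def)
      ultimately show "cinner (x - scaleC c w) y = 0"
        using xw by (metis add_0 cinner_add_right cinner_scaleC_right mult_zero_right)
    qed
    with F'(2) have "x - scaleC c w \<in> F" by blast
    from inF[OF this, of c] show "x \<in> ?F" by simp
  qed
  moreover have "?F \<inter> op_dom B \<subseteq> {0}"
  proof
    fix x assume x: "x \<in> ?F \<inter> op_dom B"
    then obtain a c where a: "a \<in> F" "x = a + scaleC c w" by blast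
    have "c = 0"
    proof (rule ccontr)
      assume c: "c \<noteq> 0"
      have "w = scaleC (inverse c) (- a + x)"
        using c a by (simp add: scaleC_scaleC scaleC_one)
      also have "\<dots> = scaleC (inverse c) (- a) + scaleC (inverse c) x"
        by (simp only: scaleC_add_right)
      also have "\<dots> \<in> set_sum F (op_dom B)"
        unfolding set_sum_def using sub(3,4) dom(3) a x by blast
      finally show False using w(2) by blast
    qed
    then show "x \<in> {0}" using a x F'(3) by auto
  qed
  ultimately show ?thesis by (simp add: admissible_def)
qed

lemma admissible_zero: "admissible {0}"
proof -
  have "orth (orth {0}) \<subseteq> {0 :: 'a}"
  proof
    fix x :: 'a assume x: "x \<in> orth (orth {0})"
    have "x \<in> orth {0}" by (rule orthI) simp
    with x show "x \<in> {0}" using orth_triv by blast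
  qed
  then show ?thesis
    by (auto simp: admissible_def is_csubspace_def)
qed

text \<open>Iterates \<open>admissible_step\<close> and \<open>admissible_extend\<close> by
  dependent choice; the growing admissible spaces stay inside the proof.\<close>

lemma transversal_sequence:
  fixes d :: "nat \<Rightarrow> 'a"
  obtains w where "\<And>n. w n \<noteq> 0" "\<And>m n. m \<noteq> n \<Longrightarrow> cinner (w m) (w n) = 0"
    "\<And>n. norm (R (w n) - d n) < inverse (real (Suc n))"
proof -
  \<comment> \<open>A state consists of the space built so far and the vector adjoined last.\<close>
  define P where "P = (\<lambda>(n::nat) (F, w :: 'a). admissible F)"
  define Q where "Q = (\<lambda>n (F, w :: 'a) (F', w'). F' = {a + scaleC c w' | a c. a \<in> F} \<and>
    w' \<in> orth F \<and> w' \<notin> set_sum F (op_dom B) \<and> norm (R w' - d n) < inverse (real (Suc n)))"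
  have "\<exists>f. \<forall>n. P n (f n) \<and> Q n (f n) (f (Suc n))"
  proof (rule dependent_nat_choice)
    show "\<exists>x. P 0 x"
      using admissible_zero unfolding P_def by auto
    fix p n assume "P n p"
    then obtain F w where p: "p = (F, w)" and F: "admissible F"
      unfolding P_def by auto
    obtain w' where "w' \<in> orth F" "w' \<notin> set_sum F (op_dom B)" "norm (R w' - d n) < inverse (real (Suc n))"
      using admissible_step[OF F, of "inverse (real (Suc n))" "d n"] by auto
    then show "\<exists>q. P (Suc n) q \<and> Q n p q"
      unfolding P_def Q_def p using admissible_extend[OF F]
      by (intro exI[of _ "({a + scaleC c w' | a c. a \<in> F}, w')"]) auto
  qed
  then obtain f where f: "\<And>n. P n (f n)" "\<And>n. Q n (f n) (f (Suc n))" by blast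
  define F where "F n = fst (f n)" for n
  \<comment> \<open>The vector in state 0 is arbitrary, so the \<open>n\<close>-th chosen vector is
    read off from state \<open>Suc n\<close>.\<close>
  define w where "w n = snd (f (Suc n))" for n
  have adm: "admissible (F n)" for n
    using f(1)[of n] by (auto simp: P_def F_def split: prod.splits)
  have F: "F (Suc n) = {a + scaleC c (w n) | a c. a \<in> F n}" and wo: "w n \<in> orth (F n)"
    and wn: "w n \<notin> set_sum (F n) (op_dom B)" and wd: "norm (R (w n) - d n) < inverse (real (Suc n))" for n
    using f(2)[of n] by (auto simp: Q_def F_def w_def split: prod.splits)
  have sub: "0 \<in> F n" for n
    using adm[of n] is_csubspaceD(1) by (auto simp: admissible_def)
  have mono: "F n \<subseteq> F (Suc n)" for n
    unfolding F using scaleC_zero_left by (metis (mono_tags, lifting) add.right_neutral mem_Collect_eq subsetI)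
  have wF: "w n \<in> F (Suc n)" for n
    unfolding F using sub[of n] by (auto intro!: exI[of _ 0] exI[of _ 1] simp: scaleC_one)
  have in_F: "w m \<in> F n" if "m < n" for m n
    using lift_Suc_mono_le[of F "Suc m" n] mono wF[of m] that by auto
  show thesis
  proof (rule that)
    show "w n \<noteq> 0" for n
      using wn[of n] sub[of n] is_csubspaceD(1)[OF is_csubspace_op_dom[OF self_adjointD(1)[OF sa]]]
      unfolding set_sum_def by force
    show "cinner (w m) (w n) = 0" if "m \<noteq> n" for m n
      using orthD[OF wo in_F] that by (metis linorder_neqE_nat)
    show "norm (R (w n) - d n) < inverse (real (Suc n))" for n
      by (fact wd)
  qed
qed

text \<open>Writing \<open>y = R' x\<close>, orthogonality of \<open>y\<close> to \<open>W\<close>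
  becomes orthogonality of \<open>x\<close> to the dense image of \<open>W\<close> under
  \<open>R\<close>.\<close>

lemma orth_dom_trivial:
  assumes w: "\<And>d e. e > 0 \<Longrightarrow> \<exists>x\<in>W. norm (R x - d) < e"
    and y: "y \<in> op_dom B" "y \<in> orth W"
  shows "y = 0"
proof -
  obtain x where x: "y = R' x" using dom_eq_R' y by blast
  have "closure (R ` W) = UNIV"
    using w by (auto simp: closure_approachable dist_norm)
  moreover have "x \<in> orth (R ` W)"
    using y(2) x by (auto intro!: orthI simp: cinner_R cinner_eq_zero_commute[of x] dest: orthD(2))
  ultimately have "x = 0" by (rule orth_dense_eq_zero)
  then have "cinner (R' x) z = 0" for z
    using cinner_R[of z x] by (simp add: cinner_eq_zero_commute[of _ z])
  then show ?thesis using x by (metis cinner_self_eq_zero)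
qed

text \<open>The odd-indexed vectors keep \<open>M k\<close> away from the domain, the even-indexed
  ones its complement, and the omitted odd vector tells the \<open>M k\<close> apart.\<close>

lemma infinitely_many_transversal:
  assumes D: "countable (D :: 'a set)" "closure D = UNIV"
  obtains M :: "nat \<Rightarrow> 'a set" where "inj M" "\<And>k. transversal (M k)"
proof -
  have "D \<noteq> {}" using D(2) by auto
  \<comment> \<open>The \<open>div 2\<close> gives \<open>2 * n\<close> and \<open>2 * n + 1\<close>
    the same target, and the first component of \<open>prod_decode\<close> takes every value
    infinitely often.\<close>
  define t where "t n = from_nat_into D (fst (prod_decode (n div 2)))" for n :: nat
  obtain w where w: "\<And>n. w n \<noteq> 0" "\<And>m n. m \<noteq> n \<Longrightarrow> cinner (w m) (w n) = 0"
    "\<And>n. norm (R (w n) - t n) < inverse (real (Suc n))"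
    using transversal_sequence[of t] by blast
  have hit: "\<exists>n\<ge>N. norm (R (w (2 * n + b)) - d) < e" if e: "e > 0" and b: "b < 2" for d e N b
  proof -
    obtain d' where d': "d' \<in> D" "norm (d' - d) < e / 2"
      using D(2) e closure_approachable[of d D] by (auto simp: dist_norm dest!: spec[of _ "e / 2"])
    obtain i where i: "from_nat_into D i = d'"
      using from_nat_into_surj[OF D(1) d'(1)] by blast
    obtain j where j: "inverse (real (Suc j)) < e / 2"
      using reals_Archimedean[of "e / 2"] e by auto
    \<comment> \<open>The free second coordinate pushes the index past \<open>N\<close> and past
      \<open>j\<close>, where the tolerance is small enough, without changing the target.\<close>
    define n where "n = prod_encode (i, max j N)"
    have n: "n \<ge> max j N"
      unfolding n_def by (rule le_prod_encode_2)
    have "(2 * n + b) div 2 = n" using b by simp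
    then have "t (2 * n + b) = d'"
      by (simp add: t_def n_def i)
    then have "norm (R (w (2 * n + b)) - d') < inverse (real (Suc (2 * n + b)))"
      using w(3)[of "2 * n + b"] by simp
    also have "\<dots> \<le> inverse (real (Suc j))"
      using n by (intro le_imp_inverse_le) auto
    finally have "norm (R (w (2 * n + b)) - d') < e / 2" using j by simp
    then have "norm (R (w (2 * n + b)) - d) < e"
      using d'(2) norm_triangle_ineq[of "R (w (2 * n + b)) - d'" "d' - d"] by simp
    then show ?thesis using n by auto
  qed
  define W where "W k = {w (2 * n + 1) | n. n \<noteq> k}" for k
  define M where "M k = orth (W k)" for k
  have odd_in: "w (2 * j + 1) \<in> M k \<longleftrightarrow> j = k" for j k
  proof
    assume "w (2 * j + 1) \<in> M k"
    then show "j = k"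
      using orthD(1)[of "w (2 * j + 1)" "W k" "w (2 * j + 1)"] w(1)[of "2 * j + 1"]
      unfolding M_def W_def by auto
  next
    assume "j = k"
    then show "w (2 * j + 1) \<in> M k"
      unfolding M_def W_def by (auto intro!: orthI w(2))
  qed
  show thesis
  proof (rule that)
    show "inj M"
      using odd_in by (metis injI)
    fix k
    have "W k \<subseteq> orth (orth (W k))"
      by (auto intro: orthI dest: orthD(2))
    then have "orth (orth (M k)) \<subseteq> M k"
      unfolding M_def by (auto intro!: orthI intro: orthD(1)[of _ "orth (orth (W k))"])
    moreover have "y = 0" if y: "y \<in> op_dom B" "y \<in> M k" for y
    proof (rule orth_dom_trivial[OF _ y(1)])
      show "y \<in> orth (W k)" using y by (simp add: M_def)
      show "\<exists>x\<in>W k. norm (R x - d) < e" if e: "e > 0" for d e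
      proof -
        \<comment> \<open>Starting at \<open>Suc k\<close> avoids the omitted index
          \<open>k\<close>.\<close>
        obtain n where "n \<ge> Suc k" "norm (R (w (2 * n + 1)) - d) < e"
          using hit[OF e, of 1 "Suc k" d] by auto
        moreover from this(1) have "w (2 * n + 1) \<in> W k"
          unfolding W_def by auto
        ultimately show ?thesis by blast
      qed
    qed
    moreover have "y = 0" if y: "y \<in> op_dom B" "y \<in> orth (M k)" for y
    proof (rule orth_dom_trivial[OF _ y(1)])
      \<comment> \<open>Even vectors are orthogonal to all odd ones, hence lie in
        \<open>M k\<close>, so \<open>y\<close> is orthogonal to each of them.\<close>
      let ?W = "range (\<lambda>n. w (2 * n))"
      have "?W \<subseteq> M k"
      proof -
        have "2 * n \<noteq> 2 * m + 1" for m n :: nat by presburger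
        then show ?thesis
          unfolding M_def W_def by (auto intro!: orthI w(2))
      qed
      then show "y \<in> orth ?W"
        using y(2) by (auto intro!: orthI dest: orthD(1))
      show "\<exists>x\<in>?W. norm (R x - d) < e" if "e > 0" for d e
        using hit[OF that, of 0 0 d] by auto
    qed
    ultimately show "transversal (M k)"
      unfolding transversal_def using is_csubspace_orth[of "W k"] closed_orth[of "W k"]
      by (auto simp: M_def)
  qed
qed

end

section \<open>Restrictions of a self-adjoint operator with full range\<close>

context self_adjoint_op
begin

context
  assumes ran: "op_ran B = UNIV"
begin

lemma ran_ex: "\<exists>f. (f, g) \<in> B"
  using ran unfolding op_ran_def by (metis UNIV_I imageE prod.collapse)

text \<open>Uniform boundedness for the \<open>f\<close> with \<open>B f\<close> in the unit ball:
  writing \<open>y = B k\<close> turns \<open>cinner f y\<close> into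
  \<open>cinner (B f) k\<close>.\<close>

lemma inverse_bounded: "\<exists>c>0. \<forall>(f, g)\<in>B. c * norm f \<le> norm g"
proof -
  let ?S = "{f. \<exists>g. (f, g) \<in> B \<and> norm g \<le> 1}"
  have "\<exists>C. \<forall>f\<in>?S. norm f \<le> C"
  proof (rule cinner_uniform_boundedness)
    fix y
    obtain k where k: "(k, y) \<in> B" using ran_ex by blast
    have "cmod (cinner f y) \<le> norm k" if f: "f \<in> ?S" for f
    proof -
      obtain g where g: "(f, g) \<in> B" "norm g \<le> 1" using f by blast
      have "cmod (cinner f y) \<le> norm g * norm k"
        using cinner_Cauchy_Schwarz[of g k] B_sym[OF g(1) k] by simp
      also have "\<dots> \<le> 1 * norm k"
        using g by (intro mult_right_mono) auto
      finally show ?thesis by simp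
    qed
    then show "\<exists>C. \<forall>f\<in>?S. cmod (cinner f y) \<le> C" by blast
  qed
  then obtain C where C: "\<And>f g. (f, g) \<in> B \<Longrightarrow> norm g \<le> 1 \<Longrightarrow> norm f \<le> C" by blast
  have C0: "C \<ge> 0" using C[OF B_op(1)] by simp
  have "inverse (C + 1) * norm f \<le> norm g" if fg: "(f, g) \<in> B" for f g
  proof (cases "g = 0")
    case True
    \<comment> \<open>Injectivity of \<open>B\<close>: with \<open>f = B k\<close>, symmetry gives
      \<open>cinner f f = cinner g k\<close>, which vanishes.\<close>
    obtain k where "(k, f) \<in> B" using ran_ex by blast
    from B_sym[OF fg this] True have "f = 0" by simp
    then show ?thesis by simp
  next
    case False
    have "(scaleC (of_real (inverse (norm g))) f, scaleC (of_real (inverse (norm g))) g) \<in> B"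
      by (rule B_op(3)[OF fg])
    from C[OF this] have "inverse (norm g) * norm f \<le> C"
      using False by (simp add: norm_scaleC norm_inverse)
    then have "norm f \<le> C * norm g"
      using False by (simp add: field_simps)
    also have "\<dots> \<le> (C + 1) * norm g"
      by (simp add: mult_right_mono)
    finally show ?thesis
      using C0 by (simp add: field_simps)
  qed
  then show ?thesis
    using C0 by (intro exI[of _ "inverse (C + 1)"]) auto
qed

lemma B_inj: "(f, g) \<in> B \<Longrightarrow> (f', g) \<in> B \<Longrightarrow> f = f'"
  using inverse_bounded B_op(4)[of f g f' g] by (auto simp: mult_le_0_iff)

context
  fixes T
  assumes T: "closed_op T" "densely_defined T" and TB: "T \<subseteq> B"
begin

lemma is_op_T: "is_op T"
  using T by (simp add: closed_op_def)

lemma is_op_TB: "is_op (op_comp T B)"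
  by (intro is_op_op_comp is_op_T self_adjointD(1)[OF sa])

text \<open>Write \<open>u = B v\<close> and any \<open>k\<close> in the domain of \<open>T\<close>
  as \<open>B f\<close>. Then \<open>f\<close> is in the domain of the product and
  \<open>(v, k) = (u, f) = 0\<close>, so \<open>v\<close> vanishes by density of the domain of
  \<open>T\<close>.\<close>

lemma dense_TB: "densely_defined (op_comp T B)"
  unfolding densely_defined_def
proof (rule dense_if_orth_trivial[OF is_csubspace_op_dom[OF is_op_TB]])
  fix u assume u: "u \<in> orth (op_dom (op_comp T B))"
  obtain v where v: "(v, u) \<in> B" using ran_ex by blast
  have "v \<in> orth (op_dom T)"
  proof (rule orthI)
    fix k assume "k \<in> op_dom T"
    then obtain h where h: "(k, h) \<in> T" by (auto simp: op_dom_iff)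
    obtain f where f: "(f, k) \<in> B" using ran_ex by blast
    have "f \<in> op_dom (op_comp T B)"
      using f h by (auto simp: op_dom_iff op_comp_def)
    then have "cinner u f = 0" by (rule orthD(1)[OF u])
    then show "cinner v k = 0" using B_sym[OF v f] by simp
  qed
  then have "v = 0"
    using T(2) orth_dense_eq_zero by (auto simp: densely_defined_def)
  then show "u = 0" using B_op(5)[OF v] B_op(1) by simp
qed

section \<open>The form of \<open>op_comp T B\<close> and its Friedrichs extension\<close>

lemma TB_cinner:
  assumes "(f, h) \<in> op_comp T B" "(f, g) \<in> B" "(f', g') \<in> B"
  shows "cinner h f' = cinner g g'"
proof -
  obtain g0 where "(f, g0) \<in> B" "(g0, h) \<in> T"
    using assms(1) by (auto simp: op_comp_def)
  then have "(g, h) \<in> B"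
    using B_op(5)[OF assms(2)] TB by auto
  then show ?thesis by (rule B_sym[OF _ assms(3)])
qed

lemma TB_cases:
  assumes "(f, h) \<in> op_comp T B"
  obtains g where "(f, g) \<in> B" "(g, h) \<in> T"
  using assms by (auto simp: op_comp_def)

lemma symmetric_TB: "symmetric_op (op_comp T B)"
  unfolding symmetric_op_def
proof (intro conjI is_op_TB dense_TB subrelI adjointI)
  fix f h f' h' assume *: "(f, h) \<in> op_comp T B" "(f', h') \<in> op_comp T B"
  obtain g where g: "(f, g) \<in> B" using TB_cases[OF *(1)] by blast
  obtain g' where g': "(f', g') \<in> B" using TB_cases[OF *(2)] by blast
  have "cinner h' f = cinner g' g" "cinner h f' = cinner g g'"
    by (rule TB_cinner[OF *(2) g' g], rule TB_cinner[OF *(1) g g'])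
  then show "cinner h' f = cinner f' h"
    by (metis cinner_commute)
qed

lemma nonneg_TB: "nonneg_op (op_comp T B)"
  unfolding nonneg_op_def
proof (clarify, goal_cases)
  case (1 f h)
  then obtain g where "(f, g) \<in> B" by (auto elim: TB_cases)
  with 1 show ?case
    using TB_cinner[of f h g f g] by (simp add: cinner_self_norm)
qed

text \<open>The form is \<open>(B f, B f')\<close>, so form-Cauchy sequences have Cauchy images
  under \<open>B\<close>, and closedness of \<open>B\<close> identifies the limit. The last clause
  evaluates the form against any vector of the domain of \<open>B\<close>.\<close>

lemma form_approx_TB:
  assumes "form_approx (op_comp T B) F f"
  shows "\<exists>G g. (\<forall>n. (F n, G n) \<in> B) \<and> (f, g) \<in> B \<and> G \<longlonglongrightarrow> g \<and>
    (\<forall>n y k. (y, k) \<in> B \<longrightarrow> cinner (op_app (op_comp T B) (F n)) y = cinner (G n) k)"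
proof -
  let ?A = "op_comp T B"
  have dom: "F n \<in> op_dom ?A" for n
    using assms by (simp add: form_approx_def)
  then have "\<exists>h. (F n, h) \<in> ?A" for n by (simp add: op_dom_iff)
  then obtain H where H: "\<And>n. (F n, H n) \<in> ?A" by metis
  then have "\<exists>g. (F n, g) \<in> B" for n by (meson TB_cases)
  then obtain G where G: "\<And>n. (F n, G n) \<in> B" by metis
  have app: "op_app ?A (F n - F m) = H n - H m" "op_app ?A (F n) = H n" for m n
    by (auto intro!: op_app_eq[OF is_op_TB] is_opD(4)[OF is_op_TB] H)
  have energy: "Re (cinner (op_app ?A (F n - F m)) (F n - F m)) = (norm (G n - G m))\<^sup>2" for m n
    unfolding app
    using TB_cinner[OF is_opD(4)[OF is_op_TB H H] B_op(4)[OF G G] B_op(4)[OF G G], of n m n m]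
    by (simp add: Re_cinner_self)
  have "Cauchy G"
  proof (rule metric_CauchyI)
    fix e :: real assume e: "e > 0"
    then have "e\<^sup>2 > 0" by simp
    then obtain N where N: "\<And>m n. m \<ge> N \<Longrightarrow> n \<ge> N \<Longrightarrow> (norm (G n - G m))\<^sup>2 < e\<^sup>2"
      using assms unfolding form_approx_def energy by blast
    have "dist (G m) (G n) < e" if "m \<ge> N" "n \<ge> N" for m n
      using N[OF that(2,1)] e power2_less_imp_less[of _ e] by (simp add: dist_norm)
    then show "\<exists>M. \<forall>m\<ge>M. \<forall>n\<ge>M. dist (G m) (G n) < e" by blast
  qed
  then obtain g where g: "G \<longlonglongrightarrow> g"
    using Cauchy_convergent convergent_def by blast
  have "F \<longlonglongrightarrow> f"
    using assms by (simp add: form_approx_def)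
  from closed_op_limit[OF closed_B G this g] have fg: "(f, g) \<in> B" .
  have "cinner (op_app ?A (F n)) y = cinner (G n) k" if "(y, k) \<in> B" for n y k
    unfolding app by (rule TB_cinner[OF H G that])
  with G fg g show ?thesis by blast
qed

text \<open>Approximate \<open>g = B f\<close> from the dense domain of \<open>T\<close> and pull
  the approximants back along \<open>B\<close>; the bounded inverse makes the preimages converge to
  \<open>f\<close>.\<close>

lemma form_approx_ex:
  assumes fg: "(f, g) \<in> B"
  shows "\<exists>F. form_approx (op_comp T B) F f"
proof -
  let ?A = "op_comp T B"
  have "g \<in> closure (op_dom T)"
    using T(2) by (simp add: densely_defined_def)
  then obtain G where G: "\<And>n. G n \<in> op_dom T" "G \<longlonglongrightarrow> g"
    unfolding closure_sequential by blast
  then obtain H where H: "\<And>n. (G n, H n) \<in> T"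
    unfolding op_dom_iff by metis
  have "\<exists>f. (f, G n) \<in> B" for n
    by (rule ran_ex)
  then obtain F where F: "\<And>n. (F n, G n) \<in> B"
    by metis
  have FA: "(F n, H n) \<in> ?A" for n
    using F H by (auto simp: op_comp_def)
  obtain c where c: "c > 0" "\<And>f g. (f, g) \<in> B \<Longrightarrow> c * norm f \<le> norm g"
    using inverse_bounded by blast
  have "F \<longlonglongrightarrow> f"
  proof (rule metric_LIMSEQ_I)
    fix e :: real assume "e > 0"
    then have "c * e > 0" using c by simp
    then obtain N where N: "\<And>n. n \<ge> N \<Longrightarrow> dist (G n) g < c * e"
      using metric_LIMSEQ_D[OF G(2)] by blast
    have "dist (F n) f < e" if "n \<ge> N" for n
    proof -
      have "c * norm (F n - f) < c * e"
        using c(2)[OF B_op(4)[OF F fg], of n] N[OF that] by (simp add: dist_norm)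
      then show ?thesis using c(1) by (simp add: dist_norm)
    qed
    then show "\<exists>N. \<forall>n\<ge>N. dist (F n) f < e" by blast
  qed
  moreover have "F n \<in> op_dom ?A" for n
    using FA by (auto simp: op_dom_iff)
  moreover have "\<exists>N. \<forall>m\<ge>N. \<forall>n\<ge>N. Re (cinner (op_app ?A (F n - F m)) (F n - F m)) < e"
    if e: "e > 0" for e
  proof -
    have "Re (cinner (op_app ?A (F n - F m)) (F n - F m)) = (norm (G n - G m))\<^sup>2" for m n
      using op_app_eq[OF is_op_TB is_opD(4)[OF is_op_TB FA FA]]
        TB_cinner[OF is_opD(4)[OF is_op_TB FA FA] B_op(4)[OF F F] B_op(4)[OF F F], of n m n m]
      by (simp add: Re_cinner_self)
    moreover obtain N where N: "\<And>m n. m \<ge> N \<Longrightarrow> n \<ge> N \<Longrightarrow> dist (G m) (G n) < sqrt e"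
      using metric_CauchyD[OF LIMSEQ_imp_Cauchy[OF G(2)], of "sqrt e"] e by auto
    have "(norm (G n - G m))\<^sup>2 < e" if "m \<ge> N" "n \<ge> N" for m n
      using power_strict_mono[OF N[OF that(2,1)], of 2] e by (simp add: dist_norm)
    ultimately show ?thesis by (auto intro!: exI[of _ N])
  qed
  ultimately show ?thesis
    by (auto simp: form_approx_def)
qed

lemma form_dom_TB: "form_dom (op_comp T B) = op_dom B"
  unfolding form_dom_def op_dom_iff set_eq_iff mem_Collect_eq
  using form_approx_ex form_approx_TB by blast

text \<open>All approximating sequences give the same limit; for the \<open>THE\<close> in
  \<open>form_val\<close> to be determined, at least one pair of them must exist, which
  \<open>form_approx_ex\<close> guarantees.\<close>

lemma form_val_TB:
  assumes u: "(u, gu) \<in> B" and v: "(v, gv) \<in> B"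
  shows "form_val (op_comp T B) u v = cinner gu gv"
proof -
  let ?A = "op_comp T B"
  have lim: "(\<lambda>n. cinner (op_app ?A (F n)) (G n)) \<longlonglongrightarrow> cinner gu gv"
    if F: "form_approx ?A F u" and G: "form_approx ?A G v" for F G
  proof -
    obtain F' u' where F': "\<forall>n. (F n, F' n) \<in> B" "(u, u') \<in> B" "F' \<longlonglongrightarrow> u'"
      "\<forall>n y k. (y, k) \<in> B \<longrightarrow> cinner (op_app ?A (F n)) y = cinner (F' n) k"
      using form_approx_TB[OF F] by (elim exE conjE)
    obtain G' v' where G': "\<forall>n. (G n, G' n) \<in> B" "(v, v') \<in> B" "G' \<longlonglongrightarrow> v'"
      using form_approx_TB[OF G] by (elim exE conjE)
    have "u' = gu" "v' = gv"
      using B_op(5) F'(2) G'(2) u v by auto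
    moreover have "cinner (op_app ?A (F n)) (G n) = cinner (F' n) (G' n)" for n
      using F'(4) G'(1) by blast
    ultimately show ?thesis
      using tendsto_cinner[OF F'(3) G'(3)] by simp
  qed
  obtain F where F: "form_approx ?A F u" using form_approx_ex[OF u] by blast
  obtain G where G: "form_approx ?A G v" using form_approx_ex[OF v] by blast
  show ?thesis
    unfolding form_val_def
  proof (rule the_equality)
    fix c assume "\<forall>F G. form_approx ?A F u \<longrightarrow> form_approx ?A G v \<longrightarrow>
        (\<lambda>n. cinner (op_app ?A (F n)) (G n)) \<longlonglongrightarrow> c"
    then have "(\<lambda>n. cinner (op_app ?A (F n)) (G n)) \<longlonglongrightarrow> c"
      using F G by blast
    then show "c = cinner gu gv"
      using lim[OF F G] LIMSEQ_unique by blast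
  qed (use lim in blast)
qed

text \<open>The associated operator asks that \<open>(B u, B v) = (w, v)\<close> for all
  \<open>v\<close> in the domain of \<open>B\<close>. By self-adjointness this says that
  \<open>B u\<close> is in the domain of \<open>B\<close> with value \<open>w\<close>.\<close>

lemma friedrichs_TB: "friedrichs_ext (op_comp T B) = op_comp B B"
proof -
  have "(u, w) \<in> friedrichs_ext (op_comp T B) \<longleftrightarrow> (u, w) \<in> op_comp B B" for u w
  proof -
    have "(u, w) \<in> friedrichs_ext (op_comp T B) \<longleftrightarrow>
        (\<exists>g. (u, g) \<in> B \<and> (\<forall>v k. (v, k) \<in> B \<longrightarrow> cinner g k = cinner w v))"
    proof
      assume "(u, w) \<in> friedrichs_ext (op_comp T B)"
      then have u: "u \<in> op_dom B"
        and uw: "\<And>v. v \<in> op_dom B \<Longrightarrow> form_val (op_comp T B) u v = cinner w v"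
        by (auto simp: friedrichs_ext_def form_dom_TB)
      from u obtain g where g: "(u, g) \<in> B" by (auto simp: op_dom_iff)
      have "cinner g k = cinner w v" if "(v, k) \<in> B" for v k
        using uw[of v] form_val_TB[OF g that] that by (auto simp: op_dom_iff)
      with g show "\<exists>g. (u, g) \<in> B \<and> (\<forall>v k. (v, k) \<in> B \<longrightarrow> cinner g k = cinner w v)"
        by blast
    next
      assume "\<exists>g. (u, g) \<in> B \<and> (\<forall>v k. (v, k) \<in> B \<longrightarrow> cinner g k = cinner w v)"
      then obtain g where g: "(u, g) \<in> B" "\<forall>v k. (v, k) \<in> B \<longrightarrow> cinner g k = cinner w v"
        by blast
      then have "form_val (op_comp T B) u v = cinner w v" if "v \<in> op_dom B" for v
        using that form_val_TB[OF g(1)] by (auto simp: op_dom_iff)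
      then show "(u, w) \<in> friedrichs_ext (op_comp T B)"
        using g(1) by (auto simp: friedrichs_ext_def form_dom_TB op_dom_iff)
    qed
    also have "\<dots> \<longleftrightarrow> (\<exists>g. (u, g) \<in> B \<and> (g, w) \<in> B)"
    proof -
      have "(\<forall>v k. (v, k) \<in> B \<longrightarrow> cinner g k = cinner w v) \<longleftrightarrow> (g, w) \<in> B" for g
      proof
        assume *: "\<forall>v k. (v, k) \<in> B \<longrightarrow> cinner g k = cinner w v"
        show "(g, w) \<in> B"
          by (rule in_BI) (metis * cinner_commute)
      qed (use B_sym in force)
      then show ?thesis by simp
    qed
    finally show ?thesis by (simp add: op_comp_def)
  qed
  then show ?thesis by auto
qed

text \<open>For the inclusion from left to right, surjectivity of \<open>B\<close> is used twice: to
  write \<open>h = B k\<close>, and to write each \<open>x\<close> in the domain of \<open>T\<close>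
  as \<open>B f\<close>, so that testing on the product tests all of \<open>T\<close>.\<close>

lemma adjoint_TB: "adjoint (op_comp T B) = op_comp B (adjoint T)"
proof (intro equalityI subrelI)
  fix g h assume gh: "(g, h) \<in> adjoint (op_comp T B)"
  obtain k where k: "(k, h) \<in> B" using ran_ex by blast
  have "(g, k) \<in> adjoint T"
  proof (rule adjointI)
    fix x t assume x: "(x, t) \<in> T"
    obtain f where f: "(f, x) \<in> B" using ran_ex by blast
    have "(f, t) \<in> op_comp T B" using f x by (auto simp: op_comp_def)
    from adjointD[OF gh this] show "cinner t g = cinner x k"
      using B_sym[OF f k] by simp
  qed
  with k show "(g, h) \<in> op_comp B (adjoint T)"
    by (auto simp: op_comp_def)
next
  fix g h assume "(g, h) \<in> op_comp B (adjoint T)"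
  then obtain k where k: "(g, k) \<in> adjoint T" "(k, h) \<in> B" by (auto simp: op_comp_def)
  show "(g, h) \<in> adjoint (op_comp T B)"
  proof (rule adjointI)
    fix f t assume "(f, t) \<in> op_comp T B"
    then obtain x where "(f, x) \<in> B" "(x, t) \<in> T" by (rule TB_cases)
    then show "cinner t g = cinner f h"
      using adjointD[OF k(1)] B_sym[OF _ k(2)] by metis
  qed
qed

text \<open>With \<open>x = (C + a)\<inverse>f\<close>, \<open>y = (TT\<^sup>* + a)\<inverse>f\<close> and \<open>Bp = T\<^sup>*y\<close> one has
  \<open>C(x - p) = a(y - x)\<close> and \<open>(y - x, f) = (C(x - p), x - p) + a\<parallel>y - x\<parallel>\<^sup>2\<close>.\<close>

lemma krein_TB: "is_krein_ext (op_comp T B) (op_comp T (adjoint T))"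
  unfolding is_krein_ext_def
proof (intro conjI allI impI)
  let ?K = "op_comp T (adjoint T)"
  note K = op_comp_adjoint_nonneg_self_adjoint[OF T]
  have "B \<subseteq> adjoint T"
    using TB B_sym by (auto intro!: adjointI)
  then have "op_comp T B \<subseteq> ?K"
    by (auto simp: op_comp_def)
  with K show "nonneg_sa_ext (op_comp T B) ?K"
    by (simp add: nonneg_sa_ext_def)
  fix C assume C: "nonneg_sa_ext (op_comp T B) C"
  then have C': "self_adjoint C" "nonneg_op C" "op_comp T B \<subseteq> C"
    by (auto simp: nonneg_sa_ext_def)
  show "resolvent_le C ?K"
    unfolding resolvent_le_def
  proof (intro allI impI)
    fix a :: real and f assume a: "a > 0"
    define x where "x = op_resolvent C a f"
    define y where "y = op_resolvent ?K a f"
    define c where "c = f - scaleR a y"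
    have x: "(x, f - scaleR a x) \<in> C"
      unfolding x_def by (rule nonneg_self_adjoint_resolvent[OF C'(1,2) a])
    have "(y, c) \<in> ?K"
      unfolding y_def c_def by (rule nonneg_self_adjoint_resolvent[OF K a])
    then obtain k where k: "(y, k) \<in> adjoint T" "(k, c) \<in> T"
      by (auto simp: op_comp_def)
    obtain p where p: "(p, k) \<in> B" using ran_ex by blast
    \<comment> \<open>As \<open>B p = k\<close> lies in the domain of \<open>T\<close>, the
      extension \<open>C\<close> sends \<open>p\<close> to \<open>c\<close>, the same value that
      \<open>?K\<close> takes at \<open>y\<close>.\<close>
    have pC: "(p, c) \<in> C"
      using C'(3) p k(2) by (auto simp: op_comp_def)
    have xp: "(x - p, scaleR a (y - x)) \<in> C"
      using is_opD(4)[OF self_adjointD(1)[OF C'(1)] x pC]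
      by (simp add: c_def algebra_simps)
    \<comment> \<open>Both \<open>cinner c p\<close> and \<open>cinner c y\<close> equal
      \<open>cinner k k\<close>, which allows \<open>p\<close> to be exchanged for \<open>y\<close>
      when paired with \<open>c\<close>.\<close>
    have "cinner c p = cinner k k"
      using B_sym[OF _ p] k(2) TB by blast
    then have e1: "Re (cinner c p) = Re (cinner c y)"
      using adjointD[OF k] by simp
    have e2: "a * Re (cinner (y - x) p) = Re (cinner (x - p) c)"
      using arg_cong[OF self_adjointD(4)[OF C'(1) xp pC], of Re] by (simp add: cinner_scaleR_left)
    have e3: "0 \<le> a * Re (cinner (y - x) (x - p))"
      using C'(2) xp by (force simp: nonneg_op_def cinner_scaleR_left)
    have "0 \<le> a * (norm (y - x))\<^sup>2" using a by simp
    then have e4: "0 \<le> a * Re (cinner (y - x) (y - x))"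
      by (simp only: Re_cinner_self)
    have f: "f = c + scaleR a y" by (simp add: c_def)
    have "Re (cinner (y - x) f) = Re (cinner (y - x) c) + a * Re (cinner (y - x) y)"
      by (simp add: f cinner_add_right cinner_scaleR_right)
    also have "Re (cinner (y - x) c) = - Re (cinner (x - p) c)"
      using e1 by (simp add: cinner_diff_left Re_cinner_commute[of c])
    also have "\<dots> + a * Re (cinner (y - x) y) =
        a * Re (cinner (y - x) (x - p)) + a * Re (cinner (y - x) (y - x))"
      unfolding e2[symmetric] by (simp add: cinner_diff_right algebra_simps)
    finally have "0 \<le> Re (cinner (y - x) f)"
      using e3 e4 by simp
    then show "Re (cinner (op_resolvent C a f) f) \<le> Re (cinner (op_resolvent ?K a f) f)"
      by (simp add: cinner_diff_left x_def y_def)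
  qed
qed

end

text \<open>As \<open>B\<close> is bijective onto the whole space, it carries the domain of
  \<open>op_comp S B\<close> onto that of \<open>S\<close>; the decomposition of the domain of
  \<open>B\<close> is pulled back.\<close>

lemma op_dom_op_comp_surj:
  assumes "T1 \<subseteq> B" "T2 \<subseteq> B"
    and dom: "op_dom T1 \<inter> op_dom T2 = {0}" "op_dom B = set_sum (op_dom T1) (op_dom T2)"
  shows "op_dom (op_comp T1 B) \<inter> op_dom (op_comp T2 B) = {0}"
    and "set_sum (op_dom (op_comp T1 B)) (op_dom (op_comp T2 B)) = op_dom (op_comp B B)"
proof -
  have iff: "f \<in> op_dom (op_comp S B) \<longleftrightarrow> (\<exists>g. (f, g) \<in> B \<and> g \<in> op_dom S)" for f S
    by (auto simp: op_dom_iff op_comp_def)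
  show "op_dom (op_comp T1 B) \<inter> op_dom (op_comp T2 B) = {0}"
  proof (intro equalityI subsetI)
    fix f assume f: "f \<in> op_dom (op_comp T1 B) \<inter> op_dom (op_comp T2 B)"
    then obtain g where g: "(f, g) \<in> B" "g \<in> op_dom T1" "g \<in> op_dom T2"
      unfolding iff Int_iff using B_op(5) by blast
    then have "g = 0" using dom by blast
    then show "f \<in> {0}" using B_inj[OF g(1)] B_op(1) by simp
  next
    fix f :: 'h assume "f \<in> {0}"
    then show "f \<in> op_dom (op_comp T1 B) \<inter> op_dom (op_comp T2 B)"
      unfolding iff Int_iff using dom(1) B_op(1) by auto
  qed
  show "set_sum (op_dom (op_comp T1 B)) (op_dom (op_comp T2 B)) = op_dom (op_comp B B)"
  proof (intro equalityI subsetI)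
    fix f assume "f \<in> set_sum (op_dom (op_comp T1 B)) (op_dom (op_comp T2 B))"
    then obtain f1 f2 g1 g2 where f: "f = f1 + f2" "(f1, g1) \<in> B" "g1 \<in> op_dom T1"
      "(f2, g2) \<in> B" "g2 \<in> op_dom T2"
      by (auto simp: set_sum_def iff)
    then have "g1 + g2 \<in> op_dom B" unfolding dom(2) set_sum_def by blast
    then show "f \<in> op_dom (op_comp B B)"
      unfolding iff using B_op(2) f by blast
  next
    fix f assume "f \<in> op_dom (op_comp B B)"
    then obtain g where g: "(f, g) \<in> B" "g \<in> op_dom B" by (auto simp: iff)
    then obtain g1 g2 where g': "g = g1 + g2" "g1 \<in> op_dom T1" "g2 \<in> op_dom T2"
      unfolding dom(2) set_sum_def by blast
    obtain f1 f2 where f: "(f1, g1) \<in> B" "(f2, g2) \<in> B" using ran_ex by blast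
    have "f = f1 + f2"
      using B_inj[OF g(1)] B_op(2)[OF f] g'(1) by simp
    then show "f \<in> set_sum (op_dom (op_comp T1 B)) (op_dom (op_comp T2 B))"
      unfolding set_sum_def using f g' iff by blast
  qed
qed

end

section \<open>Restrictions of \<open>B\<close> indexed by subspaces\<close>

definition restr :: "'h set \<Rightarrow> ('h \<times> 'h) set" where
  "restr M = {(f, g) \<in> B. g - scaleC \<i> f \<in> M}"

lemma restr_subset: "restr M \<subseteq> B"
  by (auto simp: restr_def)

lemma R_restr: "x \<in> M \<Longrightarrow> (R x, x + scaleC \<i> (R x)) \<in> restr M"
  using R_graph by (auto simp: restr_def)

lemma restr_R: "(f, g) \<in> restr M \<Longrightarrow> \<exists>x\<in>M. f = R x \<and> g = x + scaleC \<i> f"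
  using R_minus_i by (force simp: restr_def)

text \<open>Membership in \<open>restr M\<close> asks that \<open>(B - \<i>) f\<close> lie in
  \<open>M\<close>, that is, that \<open>f\<close> lie in the image of \<open>M\<close> under
  \<open>R\<close>. Phrased on the graph, this makes closedness a matter of a continuous
  preimage.\<close>

lemma op_dom_restr: "op_dom (restr M) = R ` M"
  using R_restr restr_R by (force simp: op_dom_iff)

text \<open>The space \<open>M\<close> is recovered as the set of values of \<open>B - \<i>\<close>
  on the restriction; different spaces thus give different operators.\<close>

lemma restr_inject: "restr M = restr N \<Longrightarrow> M = N"
proof -
  have "M = (\<lambda>(f, g). g - scaleC \<i> f) ` restr M" for M
  proof (intro equalityI subsetI)
    fix x assume "x \<in> M"
    from R_restr[OF this] show "x \<in> (\<lambda>(f, g). g - scaleC \<i> f) ` restr M"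
      by (rule image_eqI[rotated]) simp
  qed (auto simp: restr_def)
  then show "restr M = restr N \<Longrightarrow> M = N" by metis
qed

lemma closed_op_restr:
  assumes M: "is_csubspace M" "closed M"
  shows "closed_op (restr M)"
  unfolding closed_op_def
proof
  note sub = is_csubspaceD[OF M(1)]
  show "is_op (restr M)"
    unfolding is_op_def
  proof (intro conjI allI impI)
    show "(0, 0) \<in> restr M"
      using B_op(1) sub(1) by (simp add: restr_def)
    show "(f + f', g + g') \<in> restr M" if "(f, g) \<in> restr M" "(f', g') \<in> restr M" for f g f' g'
      using that B_op(2) sub(2)[of "g - scaleC \<i> f" "g' - scaleC \<i> f'"]
      by (simp add: restr_def scaleC_add_right algebra_simps)
    show "(scaleC c f, scaleC c g) \<in> restr M" if "(f, g) \<in> restr M" for c f g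
      using that B_op(3) sub(3)[of "g - scaleC \<i> f" c]
      by (simp add: restr_def scaleC_diff_right scaleC_scaleC mult.commute)
    show "g = 0" if "(0, g) \<in> restr M" for g
      using that B_op(5)[OF _ B_op(1)] by (simp add: restr_def)
  qed
  have "continuous_on UNIV (\<lambda>p. snd p - scaleC \<i> (fst p) :: 'h)"
    by (intro continuous_intros bounded_linear.continuous_on[OF bounded_linear_scaleC])
  then have "closed ((\<lambda>p. snd p - scaleC \<i> (fst p)) -` M)"
    by (rule closed_vimage[OF M(2)])
  moreover have "restr M = B \<inter> (\<lambda>p. snd p - scaleC \<i> (fst p)) -` M"
    by (auto simp: restr_def)
  ultimately show "closed (restr M)"
    using closed_B by auto
qed

text \<open>The condition on the complement of \<open>orth M\<close> reduces to the one on
  \<open>M\<close>, since \<open>orth (orth M)\<close> is contained in \<open>M\<close>.\<close>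

lemma transversal_orth: "transversal M \<Longrightarrow> transversal (orth M)"
proof -
  assume M: "transversal M"
  have "M \<subseteq> orth (orth M)"
    by (auto intro: orthI dest: orthD(2))
  then have "orth (orth (orth M)) \<subseteq> orth M"
    by (auto intro!: orthI intro: orthD(1)[of _ "orth (orth M)"])
  with M show ?thesis
    using is_csubspace_orth[of M] closed_orth[of M] by (auto simp: transversal_def)
qed

lemma transversal_restr:
  assumes M: "transversal M"
  shows "closed_op (restr M)" "densely_defined (restr M)"
    "op_dom (restr M) \<inter> op_dom (op_comp B B) = {0}"
    "op_dom (op_comp B (restr M)) = {0}" "op_dom (op_comp (restr M) (restr M)) = {0}"
proof -
  have M': "is_csubspace M" "closed M" "M \<inter> op_dom B \<subseteq> {0}" "orth M \<inter> op_dom B \<subseteq> {0}"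
    using M by (auto simp: transversal_def)
  show closed: "closed_op (restr M)"
    by (rule closed_op_restr[OF M'(1,2)])
  show "densely_defined (restr M)"
    unfolding densely_defined_def op_dom_restr by (rule dense_image_R[OF M'(1,4)])
  have zero: "0 \<in> op_dom (op_comp S S')" if "(0, 0) \<in> S" "(0, 0) \<in> S'" for S S' :: "('h \<times> 'h) set"
    using that by (auto simp: op_dom_iff op_comp_def)
  have restr0: "(0, 0) \<in> restr M"
    using closed is_opD(1) by (auto simp: closed_op_def)
  \<comment> \<open>If \<open>f\<close> and \<open>B f\<close> are both in the domain of
    \<open>B\<close>, so is \<open>(B - \<i>) f\<close>, which also lies in \<open>M\<close> and
    hence vanishes. All three triviality claims about domains rest on this.\<close>
  have triv: "f = 0" if f: "(f, g) \<in> restr M" and g: "g \<in> op_dom B" for f g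
  proof -
    have "f \<in> op_dom B" using f restr_subset by (auto simp: op_dom_iff)
    then have "g - scaleC \<i> f \<in> op_dom B"
      using g is_csubspaceD(3,5)[OF is_csubspace_op_dom[OF self_adjointD(1)[OF sa]]] by blast
    moreover have fg: "(f, g) \<in> B" "g - scaleC \<i> f \<in> M" using f by (auto simp: restr_def)
    ultimately have "g - scaleC \<i> f = 0" using M'(3) by blast
    then show "f = 0" using R_minus_i[OF fg(1)] by simp
  qed
  have sub: "op_dom (op_comp B (restr M)) \<subseteq> {0}"
    using triv by (fastforce simp: op_dom_iff op_comp_def)
  then show "op_dom (op_comp B (restr M)) = {0}"
    using zero[OF B_op(1) restr0] by auto
  have "op_dom (op_comp (restr M) (restr M)) \<subseteq> op_dom (op_comp B (restr M))"
    using restr_subset by (force simp: op_dom_iff op_comp_def)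
  then show "op_dom (op_comp (restr M) (restr M)) = {0}"
    using sub zero[OF restr0 restr0] by auto
  have "f = 0" if f: "f \<in> op_dom (restr M)" "f \<in> op_dom (op_comp B B)" for f
  proof -
    obtain g g' where "(f, g) \<in> restr M" "(f, g') \<in> B" "g' \<in> op_dom B"
      using f by (auto simp: op_dom_iff op_comp_def)
    then show ?thesis
      using triv[of f g] B_op(5)[of f g g'] restr_subset by blast
  qed
  moreover have "0 \<in> op_dom (restr M)" using restr0 by (auto simp: op_dom_iff)
  ultimately show "op_dom (restr M) \<inter> op_dom (op_comp B B) = {0}"
    using zero[OF B_op(1,1)] by auto
qed

text \<open>The map \<open>R\<close> is linear and injective with the domain of \<open>B\<close> as
  its range, so it transports the orthogonal decomposition into \<open>M\<close> and
  \<open>orth M\<close>.\<close>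

lemma op_dom_restr_orth:
  assumes M: "is_csubspace M" "closed M"
  shows "op_dom (restr M) \<inter> op_dom (restr (orth M)) = {0}"
    "op_dom B = set_sum (op_dom (restr M)) (op_dom (restr (orth M)))"
proof -
  show "op_dom (restr M) \<inter> op_dom (restr (orth M)) = {0}"
    unfolding op_dom_restr
  proof (intro equalityI subsetI)
    fix f assume "f \<in> R ` M \<inter> R ` orth M"
    then obtain x y where x: "f = R x" "x \<in> M" "f = R y" "y \<in> orth M" by blast
    then have "x = y" using inj_R by simp
    with x orth_triv show "f \<in> {0}" by force
  next
    fix f :: 'h assume "f \<in> {0}"
    moreover have "R 0 \<in> R ` M \<inter> R ` orth M"
      using is_csubspaceD(1) M is_csubspace_orth by blast
    ultimately show "f \<in> R ` M \<inter> R ` orth M" by simp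
  qed
  show "op_dom B = set_sum (op_dom (restr M)) (op_dom (restr (orth M)))"
  proof (intro equalityI subsetI)
    fix f assume "f \<in> op_dom B"
    then obtain x where x: "f = R x" using dom_eq_R by blast
    obtain m where m: "m \<in> M" "x - m \<in> orth M" using orth_projection[OF M] by blast
    have "f = R m + R (x - m)" by (simp add: x flip: R_add)
    then show "f \<in> set_sum (op_dom (restr M)) (op_dom (restr (orth M)))"
      unfolding op_dom_restr set_sum_def using m by blast
  next
    fix f assume "f \<in> set_sum (op_dom (restr M)) (op_dom (restr (orth M)))"
    then obtain x y where "f = R x + R y"
      unfolding op_dom_restr set_sum_def by blast
    then have "f = R (x + y)" by (simp add: R_add)
    then show "f \<in> op_dom B" using R_graph[of "x + y"] by (auto simp: op_dom_iff)
  qed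
qed

end

theorem theorem3p31:
  fixes B :: "('h::complex_hilbert \<times> 'h) set"
  assumes H: "separable_infdim TYPE('h)"
    and sa: "self_adjoint B"
    and ub: "unbounded_op B"
  shows "infinite {(B1, B2). 
      closed_op B1 \<and> densely_defined B1 \<and> B1 \<subseteq> B \<and>
      closed_op B2 \<and> densely_defined B2 \<and> B2 \<subseteq> B \<and>
      op_dom B1 \<inter> op_dom B2 = {0} \<and>
      op_dom B = set_sum (op_dom B1) (op_dom B2) \<and>
      op_dom B1 \<inter> op_dom (op_comp B B) = {0} \<and>
      op_dom B2 \<inter> op_dom (op_comp B B) = {0} \<and>
      op_dom (op_comp B B1) = {0} \<and> op_dom (op_comp B B2) = {0} \<and>
      op_dom (op_comp B1 B1) = {0} \<and> op_dom (op_comp B2 B2) = {0} \<and>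
      (op_ran B = UNIV \<longrightarrow>
         (\<forall>Bk \<in> {B1, B2}.
            densely_defined (op_comp Bk B) \<and> symmetric_op (op_comp Bk B) \<and>
            nonneg_op (op_comp Bk B) \<and>
            friedrichs_ext (op_comp Bk B) = op_comp B B \<and>
            adjoint (op_comp Bk B) = op_comp B (adjoint Bk) \<and>
            is_krein_ext (op_comp Bk B) (op_comp Bk (adjoint Bk))) \<and>
         op_dom (op_comp B1 B) \<inter> op_dom (op_comp B2 B) = {0} \<and>
         set_sum (op_dom (op_comp B1 B)) (op_dom (op_comp B2 B)) = op_dom (op_comp B B))}"
    (is "infinite ?S")
proof -
  interpret unbounded_self_adjoint_op B
    by unfold_locales (fact sa ub)+
  obtain D :: "'h set" where D: "countable D" "closure D = UNIV"
    using H by (auto simp: separable_infdim_def)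
  obtain M :: "nat \<Rightarrow> 'h set" where M: "inj M" "\<And>k. transversal (M k)"
    using infinitely_many_transversal[OF D] by blast
  have pair: "(restr (M k), restr (orth (M k))) \<in> ?S" for k
  proof -
    have sub: "is_csubspace (M k)" "closed (M k)"
      using M(2)[of k] by (auto simp: transversal_def)
    note r1 = transversal_restr[OF M(2)[of k]]
      and r2 = transversal_restr[OF transversal_orth[OF M(2)[of k]]]
      and dom = op_dom_restr_orth[OF sub]
    show ?thesis
      unfolding mem_Collect_eq prod.case
    proof (intro conjI impI r1 r2 dom restr_subset ballI)
      assume ran: "op_ran B = UNIV"
      show "op_dom (op_comp (restr (M k)) B) \<inter> op_dom (op_comp (restr (orth (M k))) B) = {0}"
        "set_sum (op_dom (op_comp (restr (M k)) B)) (op_dom (op_comp (restr (orth (M k))) B))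
          = op_dom (op_comp B B)"
        by (rule op_dom_op_comp_surj[OF ran restr_subset restr_subset dom])+
      fix T assume "T \<in> {restr (M k), restr (orth (M k))}"
      then have T: "closed_op T" "densely_defined T" "T \<subseteq> B"
        using r1(1,2) r2(1,2) restr_subset by (metis insertE singletonD)+
      show "densely_defined (op_comp T B)" "symmetric_op (op_comp T B)" "nonneg_op (op_comp T B)"
        "friedrichs_ext (op_comp T B) = op_comp B B" "adjoint (op_comp T B) = op_comp B (adjoint T)"
        "is_krein_ext (op_comp T B) (op_comp T (adjoint T))"
        using dense_TB[OF ran T] symmetric_TB[OF ran T] nonneg_TB[OF ran T] friedrichs_TB[OF ran T]
          adjoint_TB[OF ran T] krein_TB[OF ran T] by auto
    qed
  qed
  \<comment> \<open>The first components alone already separate the pairs.\<close>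
  have "inj (\<lambda>k. (restr (M k), restr (orth (M k))))"
    using M(1) restr_inject by (auto intro!: injI dest: injD)
  then have "infinite (range (\<lambda>k. (restr (M k), restr (orth (M k)))))"
    by (rule range_inj_infinite)
  then show ?thesis
    using pair infinite_super by (metis (no_types, lifting) image_subsetI)
qed

end
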